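(* Let $V$ be a model of set theory, let $X\in V$ be an infinite set, let $\mathscr{L}\in V$ be a relational language, and let $\mathbf{K}$ be (in $V$) a non-trivial strong Fraïssé class of finite $\mathscr{L}$-structures. If $G$ is generic for $\mathfrak{C}_X(\mathbf{K})$ over $V$, then there is an $H\in V[G]$ which is generic over $V$ for the Cohen forcing $\mathbb{C}[X]$.
   Context: A model of set theory is a transitive model of ZFC. Fraïssé classes: let $\mathbf{K}$ be a collection of finite $\mathscr{L}$-structures closed under isomorphism. $\mathbf{K}$ has HP if every substructure of a member is a member. It has JEP if any two members embed in a common member. It has the strong amalgamation property SAP if for all $\mathcal{M}_0,\mathcal{M}_1,\mathcal{M}_2\in\mathbf{K}$ and embeddings $i_1:\mathcal{M}_0\to\mathcal{M}_1$, $i_2:\mathcal{M}_0\to\mathcal{M}_2$ there are $\mathcal{M}_3\in\mathbf{K}$ and embeddings $j_1:\mathcal{M}_1\to\mathcal{M}_3$, $j_2:\mathcal{M}_2\to\mathcal{M}_3$ with $j_1\circ i_1=j_2\circ i_2$ and $j_1[M_1]\cap j_2[M_2]=(j_1\circ i_1)[M_0]$. A strong Fraïssé class is such a $\mathbf{K}$ with HP, JEP and SAP. An $\mathscr{L}$-literal is an atomic $\mathscr{L}$-formula or a (possibly iterated) negation of one; its arity is its number of free variables. A strong Fraïssé class $\mathbf{K}$ is trivial if for every literal $\psi$, say of arity $n$, either for all $\mathcal{A}\in\mathbf{K}$ the formula $\psi$ holds of every $n$-tuple of pairwise distinct elements of $\mathcal{A}$, or for all $\mathcal{A}\in\mathbf{K}$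 the formula $\neg\psi$ holds of every $n$-tuple of pairwise distinct elements of $\mathcal{A}$. Non-trivial means not trivial. $\mathfrak{C}_X(\mathbf{K})$ is the partial order of all elements of $\mathbf{K}$ whose underlying set is a (finite) subset of $X$, with $\mathcal{A}\le\mathcal{B}$ ($\mathcal{A}$ stronger) iff $\mathcal{B}$ is a substructure of $\mathcal{A}$. $\mathbb{C}[X]$ is the partial order of finite partial functions from $X$ to $\{0,1\}$, ordered by reverse inclusion. "Generic over $V$" means a generic filter over $V$ for the indicated partial order. *)

theory Defs
  imports Main "HOL-Library.Countable_Set"
begin

section \<open>An ambient universe of sets\<close>

text \<open>Transitive models and their generic extensions need a universe of sets to live in. Here it is
  the type \<open>'a hset\<close> of well-founded sets of hereditary cardinality at most
  \<open>max(\<aleph>\<^sub>0, |'a|)\<close>: well-founded trees, with branching indexed by \<open>'a + nat\<close>,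
  modulo extensional equality. Since \<open>'a\<close> is arbitrary, so is the bound on the cardinality.\<close>

datatype 'a set_code = Code (branch: "'a + nat \<Rightarrow> 'a set_code option")

definition members :: "'a set_code \<Rightarrow> 'a set_code set" where
  "members s = {t. Some t \<in> range (branch s)}"

inductive same_set :: "'a set_code \<Rightarrow> 'a set_code \<Rightarrow> bool" where
  "\<lbrakk>\<forall>x\<in>members s. \<exists>y\<in>members t. same_set x y; \<forall>y\<in>members t. \<exists>x\<in>members s. same_set x y\<rbrakk>
    \<Longrightarrow> same_set s t"

lemma set_code_induct:
  assumes "\<And>s. (\<And>t. t \<in> members s \<Longrightarrow> P t) \<Longrightarrow> P s"
  shows "P s"
proof (induction s)
  case (Code f)
  show ?case
  proof (rule assms)
    fix t assume "t \<in> members (Code f)"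
    then obtain i where "f i = Some t" unfolding members_def by (metis imageE mem_Collect_eq set_code.sel)
    then show "P t" using Code[of "f i" t] by (metis option.set_intros rangeI)
  qed
qed

lemma same_set_refl: "same_set s s"
  by (induction s rule: set_code_induct) (blast intro: same_set.intros)

lemma same_set_sym: "same_set s t \<Longrightarrow> same_set t s"
  by (induction rule: same_set.induct) (blast intro: same_set.intros)

lemma same_set_trans: "same_set s t \<Longrightarrow> same_set t u \<Longrightarrow> same_set s u"
proof (induction arbitrary: u rule: same_set.induct)
  case (1 s t)
  have "(\<forall>x\<in>members t. \<exists>y\<in>members u. same_set x y) \<and> (\<forall>y\<in>members u. \<exists>x\<in>members t. same_set x y)"
    using 1(3) by (cases rule: same_set.cases) auto
  then show ?case
    using 1(1,2) by (intro same_set.intros) (meson)+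
qed

quotient_type 'a hset = "'a set_code" / same_set
  by (intro equivpI reflpI sympI transpI)
     (auto intro: same_set_refl same_set_sym same_set_trans)

definition elts :: "'a hset \<Rightarrow> 'a hset set" where
  "elts x = abs_hset ` members (rep_hset x)"

text \<open>Meaningful only for those \<open>S\<close> that are small enough to be the extension of a set, see
  \<open>elts_vset_countable\<close> and \<open>elts_vset_image\<close> below.\<close>
definition vset :: "'a hset set \<Rightarrow> 'a hset" where
  "vset S = (THE x. elts x = S)"

lemma abs_hset_eq_iff: "abs_hset s = abs_hset t \<longleftrightarrow> same_set s t"
  by (meson Quotient3_hset Quotient3_rel same_set_refl)

lemma same_set_rep: "same_set (rep_hset (abs_hset s)) s"
  by (meson Quotient3_abs_rep Quotient3_hset abs_hset_eq_iff)

lemma elts_abs: "elts (abs_hset s) = abs_hset ` members s"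
  using same_set_rep[of s] unfolding elts_def
  by (cases rule: same_set.cases) (auto simp: image_iff abs_hset_eq_iff; meson same_set_sym)+

lemma hset_ext: "elts x = elts y \<Longrightarrow> x = y"
proof -
  assume eq: "elts x = elts y"
  have "same_set (rep_hset x) (rep_hset y)"
  proof (rule same_set.intros; intro ballI)
    fix s assume "s \<in> members (rep_hset x)"
    then have "abs_hset s \<in> abs_hset ` members (rep_hset y)" using eq by (auto simp: elts_def)
    then show "\<exists>t\<in>members (rep_hset y). same_set s t" by (auto simp: abs_hset_eq_iff)
  next
    fix t assume "t \<in> members (rep_hset y)"
    then have "abs_hset t \<in> abs_hset ` members (rep_hset x)" using eq by (auto simp: elts_def)
    then show "\<exists>s\<in>members (rep_hset x). same_set s t"
      unfolding image_iff abs_hset_eq_iff by (meson same_set_sym)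
  qed
  then show "x = y"
    by (metis Quotient3_abs_rep Quotient3_hset abs_hset_eq_iff)
qed

lemma hset_induct [case_names step]:
  assumes "\<And>x. (\<And>y. y \<in> elts x \<Longrightarrow> P y) \<Longrightarrow> P x"
  shows "P x"
proof -
  have "P (abs_hset s)" for s
  proof (induction s rule: set_code_induct)
    fix s assume IH: "\<And>t. t \<in> members s \<Longrightarrow> P (abs_hset t)"
    show "P (abs_hset s)"
    proof (rule assms)
      fix y assume "y \<in> elts (abs_hset s)"
      then obtain t where "t \<in> members s" "y = abs_hset t" unfolding elts_abs by blast
      then show "P y" using IH by simp
    qed
  qed
  from this[of "rep_hset x"] show ?thesis
    by (simp add: Quotient3_abs_rep[OF Quotient3_hset])
qed

lemma wf_elts: "wf {(x :: 'a hset, y). x \<in> elts y}"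
proof (rule wfUNIVI)
  fix P and x :: "'a hset"
  assume "\<forall>x. (\<forall>y. (y, x) \<in> {(x :: 'a hset, y). x \<in> elts y} \<longrightarrow> P y) \<longrightarrow> P x"
  then show "P x" by (induction x rule: hset_induct) simp
qed

lemma vset_elts [simp]: "vset (elts x) = x"
  unfolding vset_def by (rule the_equality) (auto intro: hset_ext)

lemma ex_elts:
  fixes f :: "'a + nat \<Rightarrow> 'a hset option"
  shows "\<exists>x. elts x = {y. Some y \<in> range f}"
proof
  define c where "c = Code (\<lambda>i. map_option rep_hset (f i))"
  have "members c = rep_hset ` {y. Some y \<in> range f}"
  proof (intro equalityI subsetI)
    fix t assume "t \<in> members c"
    then obtain i where "map_option rep_hset (f i) = Some t"
      unfolding members_def c_def by (metis imageE mem_Collect_eq set_code.sel)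
    then show "t \<in> rep_hset ` {y. Some y \<in> range f}"
      by (metis (mono_tags, lifting) image_eqI map_option_eq_Some mem_Collect_eq rangeI)
  next
    fix t assume "t \<in> rep_hset ` {y. Some y \<in> range f}"
    then obtain y i where "t = rep_hset y" "f i = Some y"
      by (auto simp: image_iff)
    then have "branch c i = Some t" by (simp add: c_def)
    then show "t \<in> members c" by (metis members_def mem_Collect_eq rangeI)
  qed
  then show "elts (abs_hset c) = {y. Some y \<in> range f}"
    by (simp add: elts_abs image_image Quotient3_abs_rep[OF Quotient3_hset])
qed

lemma elts_vset_image:
  fixes x :: "'a hset" and h :: "'a hset \<Rightarrow> 'a hset"
  assumes "S \<subseteq> h ` elts x"
  shows "elts (vset S) = S"
proof -
  let ?b = "branch (rep_hset x)"
  define f where "f i = (case ?b i of None \<Rightarrow> None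
      | Some t \<Rightarrow> (if h (abs_hset t) \<in> S then Some (h (abs_hset t)) else None))" for i
  have "{y. Some y \<in> range f} = S"
  proof (intro equalityI subsetI)
    fix y assume "y \<in> {y. Some y \<in> range f}"
    then obtain i where "f i = Some y" by (metis imageE mem_Collect_eq)
    then show "y \<in> S" by (auto simp: f_def split: option.splits if_splits)
  next
    fix y assume y: "y \<in> S"
    then obtain t i where "y = h (abs_hset t)" "?b i = Some t"
      using assms unfolding elts_def members_def by (smt (verit) imageE mem_Collect_eq subsetD)
    then have "f i = Some y" using y by (simp add: f_def)
    then show "y \<in> {y. Some y \<in> range f}" by (metis mem_Collect_eq rangeI)
  qed
  with ex_elts[of f] show ?thesis by (metis vset_elts)
qed

lemma elts_vset_countable:
  assumes "countable S"
  shows "elts (vset S) = (S :: 'a hset set)"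
proof -
  obtain x where x: "elts x = (S :: 'a hset set)"
  proof (cases "S = {}")
    case True
    then show ?thesis using ex_elts[of "\<lambda>_. None"] that by auto
  next
    case False
    define f :: "'a + nat \<Rightarrow> 'a hset option" where
      "f = (\<lambda>i. case i of Inl _ \<Rightarrow> None | Inr n \<Rightarrow> Some (from_nat_into S n))"
    have "{y. Some y \<in> range f} = range (from_nat_into S)"
    proof (intro equalityI subsetI)
      fix y assume "y \<in> {y. Some y \<in> range f}"
      then obtain i where "f i = Some y" by (metis imageE mem_Collect_eq)
      then show "y \<in> range (from_nat_into S)"
        by (auto simp: f_def split: sum.splits)
    next
      fix y assume "y \<in> range (from_nat_into S)"
      then obtain n where "f (Inr n) = Some y" by (auto simp: f_def)
      then show "y \<in> {y. Some y \<in> range f}" by (metis mem_Collect_eq rangeI)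
    qed
    then show ?thesis
      using ex_elts[of f] range_from_nat_into[OF False assms] that by metis
  qed
  then show ?thesis by (metis vset_elts)
qed

definition vpair :: "'a hset \<Rightarrow> 'a hset \<Rightarrow> 'a hset" where
  "vpair a b = vset {vset {a}, vset {a, b}}"

lemma vpair_inject [simp]: "vpair a b = vpair c d \<longleftrightarrow> a = c \<and> b = d"
proof -
  have fin: "elts (vset S) = S" if "finite S" for S :: "'a hset set"
    by (simp add: elts_vset_countable countable_finite that)
  have inj: "vset S = vset T \<longleftrightarrow> S = T" if "finite S" "finite T" for S T :: "'a hset set"
    by (metis fin that)
  show ?thesis
    unfolding vpair_def by (auto simp: inj doubleton_eq_iff)
qed

definition vfst :: "'a hset \<Rightarrow> 'a hset" where
  "vfst p = (THE a. \<exists>b. p = vpair a b)"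

definition vsnd :: "'a hset \<Rightarrow> 'a hset" where
  "vsnd p = (THE b. \<exists>a. p = vpair a b)"

definition vdom :: "'a hset \<Rightarrow> 'a hset set" where
  "vdom f = {a. \<exists>b. vpair a b \<in> elts f}"

definition vapp :: "'a hset \<Rightarrow> 'a hset \<Rightarrow> 'a hset" where
  "vapp f a = (THE b. vpair a b \<in> elts f)"

definition is_fun :: "'a hset \<Rightarrow> bool" where
  "is_fun f \<longleftrightarrow> (\<forall>z\<in>elts f. \<exists>a b. z = vpair a b) \<and>
    (\<forall>a b c. vpair a b \<in> elts f \<and> vpair a c \<in> elts f \<longrightarrow> b = c)"

definition maps :: "'a hset \<Rightarrow> 'a hset set \<Rightarrow> 'a hset set \<Rightarrow> bool" where
  "maps f A B \<longleftrightarrow> is_fun f \<and> vdom f = A \<and> (\<forall>a\<in>A. vapp f a \<in> B)"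

primrec vnat :: "nat \<Rightarrow> 'a hset" where
  "vnat 0 = vset {}"
| "vnat (Suc n) = vset (insert (vnat n) (elts (vnat n)))"

text \<open>Tuples of length \<open>n\<close> are functions with domain \<open>n = {0, \<dots>, n - 1}\<close>.\<close>

definition vtuples :: "nat \<Rightarrow> 'a hset set \<Rightarrow> 'a hset set" where
  "vtuples n A = {t. maps t (elts (vnat n)) A}"

definition vtuple :: "'a hset list \<Rightarrow> 'a hset" where
  "vtuple as = vset {vpair (vnat i) (as ! i) | i. i < length as}"


section \<open>Transitive models of ZFC\<close>

text \<open>Formulas of set theory, with de Bruijn indices.\<close>

datatype fm = FMem nat nat | FEq nat nat | FNeg fm | FConj fm fm | FAll fm

primrec sats :: "'a hset set \<Rightarrow> (nat \<Rightarrow> 'a hset) \<Rightarrow> fm \<Rightarrow> bool" where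
  "sats M e (FMem i j) \<longleftrightarrow> e i \<in> elts (e j)"
| "sats M e (FEq i j) \<longleftrightarrow> e i = e j"
| "sats M e (FNeg \<phi>) \<longleftrightarrow> \<not> sats M e \<phi>"
| "sats M e (FConj \<phi> \<psi>) \<longleftrightarrow> sats M e \<phi> \<and> sats M e \<psi>"
| "sats M e (FAll \<phi>) \<longleftrightarrow> (\<forall>x\<in>M. sats M (case_nat x e) \<phi>)"

text \<open>The single axioms of ZFC are spelled out relativized to \<open>M\<close>, i.e. as \<open>M \<Turnstile> axiom\<close>
  unfolds; the two schemes range over all formulas with parameters from \<open>M\<close>.\<close>

definition extensionality :: "'a hset set \<Rightarrow> bool" where
  "extensionality M \<longleftrightarrow>
    (\<forall>x\<in>M. \<forall>y\<in>M. (\<forall>z\<in>M. z \<in> elts x \<longleftrightarrow> z \<in> elts y) \<longrightarrow> x = y)"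

definition foundation :: "'a hset set \<Rightarrow> bool" where
  "foundation M \<longleftrightarrow>
    (\<forall>x\<in>M. (\<exists>y\<in>M. y \<in> elts x) \<longrightarrow>
      (\<exists>y\<in>M. y \<in> elts x \<and> \<not> (\<exists>z\<in>M. z \<in> elts x \<and> z \<in> elts y)))"

definition pairing :: "'a hset set \<Rightarrow> bool" where
  "pairing M \<longleftrightarrow> (\<forall>x\<in>M. \<forall>y\<in>M. \<exists>u\<in>M. \<forall>z\<in>M. z \<in> elts u \<longleftrightarrow> z = x \<or> z = y)"

definition union_axiom :: "'a hset set \<Rightarrow> bool" where
  "union_axiom M \<longleftrightarrow>
    (\<forall>x\<in>M. \<exists>u\<in>M. \<forall>z\<in>M. z \<in> elts u \<longleftrightarrow> (\<exists>y\<in>M. y \<in> elts x \<and> z \<in> elts y))"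

definition power_set :: "'a hset set \<Rightarrow> bool" where
  "power_set M \<longleftrightarrow>
    (\<forall>x\<in>M. \<exists>u\<in>M. \<forall>z\<in>M. z \<in> elts u \<longleftrightarrow> (\<forall>y\<in>M. y \<in> elts z \<longrightarrow> y \<in> elts x))"

definition infinity :: "'a hset set \<Rightarrow> bool" where
  "infinity M \<longleftrightarrow>
    (\<exists>w\<in>M. (\<exists>z\<in>M. z \<in> elts w \<and> (\<forall>y\<in>M. y \<notin> elts z)) \<and>
      (\<forall>x\<in>M. x \<in> elts w \<longrightarrow>
        (\<exists>s\<in>M. s \<in> elts w \<and> (\<forall>z\<in>M. z \<in> elts s \<longleftrightarrow> z \<in> elts x \<or> z = x))))"

definition separation :: "'a hset set \<Rightarrow> bool" where
  "separation M \<longleftrightarrow>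
    (\<forall>\<phi> e. range e \<subseteq> M \<longrightarrow>
      (\<forall>a\<in>M. \<exists>u\<in>M. \<forall>x\<in>M. x \<in> elts u \<longleftrightarrow> x \<in> elts a \<and> sats M (case_nat x e) \<phi>))"

definition replacement :: "'a hset set \<Rightarrow> bool" where
  "replacement M \<longleftrightarrow>
    (\<forall>\<phi> e. range e \<subseteq> M \<longrightarrow>
      (\<forall>a\<in>M.
        (\<forall>x\<in>M. x \<in> elts a \<longrightarrow>
          (\<forall>y\<in>M. \<forall>z\<in>M. sats M (case_nat x (case_nat y e)) \<phi> \<and>
             sats M (case_nat x (case_nat z e)) \<phi> \<longrightarrow> y = z)) \<longrightarrow>
        (\<exists>u\<in>M. \<forall>y\<in>M. y \<in> elts u \<longleftrightarrow>
          (\<exists>x\<in>M. x \<in> elts a \<and> sats M (case_nat x (case_nat y e)) \<phi>))))"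

definition choice_axiom :: "'a hset set \<Rightarrow> bool" where
  "choice_axiom M \<longleftrightarrow>
    (\<forall>a\<in>M.
      (\<forall>x\<in>M. x \<in> elts a \<longrightarrow> (\<exists>y\<in>M. y \<in> elts x)) \<and>
      (\<forall>x\<in>M. \<forall>y\<in>M. x \<in> elts a \<and> y \<in> elts a \<and> x \<noteq> y \<longrightarrow>
        \<not> (\<exists>z\<in>M. z \<in> elts x \<and> z \<in> elts y)) \<longrightarrow>
      (\<exists>c\<in>M. \<forall>x\<in>M. x \<in> elts a \<longrightarrow> (\<exists>!y. y \<in> M \<and> y \<in> elts x \<and> y \<in> elts c)))"

definition ZFC :: "'a hset set \<Rightarrow> bool" where
  "ZFC M \<longleftrightarrow> extensionality M \<and> foundation M \<and> pairing M \<and> union_axiom M \<and> power_set M \<and>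
    infinity M \<and> separation M \<and> replacement M \<and> choice_axiom M"

definition model_of_set_theory :: "'a hset set \<Rightarrow> bool" where
  "model_of_set_theory V \<longleftrightarrow> (\<forall>x\<in>V. elts x \<subseteq> V) \<and> ZFC V"

text \<open>The classes of \<open>V\<close> are those definable over \<open>V\<close> with parameters. A collection of
  structures which is closed under isomorphism is a proper class of \<open>V\<close>, not an element.\<close>
definition class_of :: "'a hset set \<Rightarrow> 'a hset set \<Rightarrow> bool" where
  "class_of V K \<longleftrightarrow>
    (\<exists>\<phi> e. range e \<subseteq> V \<and> K = {x\<in>V. sats V (case_nat x e) \<phi>})"


section \<open>Generic filters and generic extensions\<close>

text \<open>A partial order is given by its set \<open>P\<close> of conditions and its order \<open>le\<close>, where
  \<open>le p q\<close> says that \<open>p\<close> is the stronger condition.\<close>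

definition dense_set :: "'a hset set \<Rightarrow> ('a hset \<Rightarrow> 'a hset \<Rightarrow> bool) \<Rightarrow> 'a hset set \<Rightarrow> bool" where
  "dense_set P le D \<longleftrightarrow> D \<subseteq> P \<and> (\<forall>p\<in>P. \<exists>d\<in>D. le d p)"

definition filter_on :: "'a hset set \<Rightarrow> ('a hset \<Rightarrow> 'a hset \<Rightarrow> bool) \<Rightarrow> 'a hset set \<Rightarrow> bool" where
  "filter_on P le G \<longleftrightarrow> G \<subseteq> P \<and> G \<noteq> {} \<and>
    (\<forall>p\<in>G. \<forall>q\<in>P. le p q \<longrightarrow> q \<in> G) \<and>
    (\<forall>p\<in>G. \<forall>q\<in>G. \<exists>r\<in>G. le r p \<and> le r q)"

definition generic_over ::
    "'a hset set \<Rightarrow> 'a hset set \<Rightarrow> ('a hset \<Rightarrow> 'a hset \<Rightarrow> bool) \<Rightarrow> 'a hset \<Rightarrow> bool" where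
  "generic_over V P le G \<longleftrightarrow> filter_on P le (elts G) \<and>
    (\<forall>D\<in>V. dense_set P le (elts D) \<longrightarrow> elts G \<inter> elts D \<noteq> {})"

inductive is_name :: "'a hset set \<Rightarrow> 'a hset \<Rightarrow> bool" for P where
  "(\<forall>z\<in>elts \<tau>. \<exists>\<sigma> p. z = vpair \<sigma> p \<and> p \<in> P \<and> is_name P \<sigma>) \<Longrightarrow> is_name P \<tau>"

lemma wf_name_component: "wf {(\<sigma>, \<tau>). \<exists>p. vpair \<sigma> p \<in> elts \<tau>}"
proof (rule wf_subset[OF wf_trancl[OF wf_elts]], clarify)
  let ?r = "{(x :: 'a hset, y). x \<in> elts y}"
  fix \<sigma> \<tau> p :: "'a hset" assume "vpair \<sigma> p \<in> elts \<tau>"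
  moreover have "vset {\<sigma>} \<in> elts (vpair \<sigma> p)" "\<sigma> \<in> elts (vset {\<sigma>})"
    unfolding vpair_def by (simp_all add: elts_vset_countable countable_finite)
  ultimately have "(\<sigma>, vset {\<sigma>}) \<in> ?r" "(vset {\<sigma>}, vpair \<sigma> p) \<in> ?r" "(vpair \<sigma> p, \<tau>) \<in> ?r"
    by simp_all
  then show "(\<sigma>, \<tau>) \<in> ?r\<^sup>+"
    by (blast intro: trancl.intros)
qed

text \<open>The evaluation \<open>\<tau>\<^sub>G = {\<sigma>\<^sub>G | (\<sigma>, p) \<in> \<tau>, p \<in> G}\<close>.\<close>

function val :: "'a hset \<Rightarrow> 'a hset \<Rightarrow> 'a hset" where
  "val G \<tau> = vset (val G ` {\<sigma>. \<exists>p\<in>elts G. vpair \<sigma> p \<in> elts \<tau>})"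
  by auto
termination
  by (relation "inv_image {(\<sigma>, \<tau>). \<exists>p. vpair \<sigma> p \<in> elts \<tau>} snd")
     (auto simp: wf_name_component)

declare val.simps [simp del]

lemma elts_val: "elts (val G \<tau>) = {val G \<sigma> | \<sigma> p. p \<in> elts G \<and> vpair \<sigma> p \<in> elts \<tau>}"
proof -
  have fst: "vfst (vpair a b) = a" for a b :: "'a hset"
    unfolding vfst_def by auto
  have "val G ` {\<sigma>. \<exists>p\<in>elts G. vpair \<sigma> p \<in> elts \<tau>} \<subseteq> (\<lambda>z. val G (vfst z)) ` elts \<tau>"
    by (force simp: fst image_iff)
  from elts_vset_image[OF this] show ?thesis
    by (subst val.simps) auto
qed

definition generic_extension :: "'a hset set \<Rightarrow> 'a hset set \<Rightarrow> 'a hset \<Rightarrow> 'a hset set" where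
  "generic_extension V P G = {val G \<tau> | \<tau>. \<tau> \<in> V \<and> is_name P \<tau>}"


section \<open>Relational structures\<close>

text \<open>A relational language is a function from its set of relation symbols to the natural numbers,
  assigning the arities; a structure is a pair of its underlying set and the function which
  interprets the relation symbols. Arities may be \<open>0\<close>, and underlying sets may be empty.\<close>

definition relational_language :: "'a hset \<Rightarrow> bool" where
  "relational_language L \<longleftrightarrow> maps L (vdom L) (range vnat)"

definition arity :: "'a hset \<Rightarrow> 'a hset \<Rightarrow> nat" where
  "arity L R = (THE n. vapp L R = vnat n)"

definition carr :: "'a hset \<Rightarrow> 'a hset set" where
  "carr M = elts (vfst M)"

definition interp :: "'a hset \<Rightarrow> 'a hset \<Rightarrow> 'a hset set" where
  "interp M R = elts (vapp (vsnd M) R)"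

definition is_structure :: "'a hset \<Rightarrow> 'a hset \<Rightarrow> bool" where
  "is_structure L M \<longleftrightarrow> (\<exists>A I. M = vpair A I \<and> maps I (vdom L) UNIV) \<and>
    (\<forall>R\<in>vdom L. interp M R \<subseteq> vtuples (arity L R) (carr M))"

definition substructure :: "'a hset \<Rightarrow> 'a hset \<Rightarrow> 'a hset \<Rightarrow> bool" where
  "substructure L N M \<longleftrightarrow> is_structure L N \<and> is_structure L M \<and> carr N \<subseteq> carr M \<and>
    (\<forall>R\<in>vdom L. interp N R = interp M R \<inter> vtuples (arity L R) (carr N))"

definition embedding :: "'a hset \<Rightarrow> 'a hset \<Rightarrow> 'a hset \<Rightarrow> 'a hset \<Rightarrow> bool" where
  "embedding L f M N \<longleftrightarrow> maps f (carr M) (carr N) \<and> inj_on (vapp f) (carr M) \<and>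
    (\<forall>R\<in>vdom L. \<forall>as. length as = arity L R \<and> set as \<subseteq> carr M \<longrightarrow>
      (vtuple as \<in> interp M R \<longleftrightarrow> vtuple (map (vapp f) as) \<in> interp N R))"

definition isomorphism :: "'a hset \<Rightarrow> 'a hset \<Rightarrow> 'a hset \<Rightarrow> 'a hset \<Rightarrow> bool" where
  "isomorphism L f M N \<longleftrightarrow> embedding L f M N \<and> vapp f ` carr M = carr N"


section \<open>Strong Fraisse classes in \<open>V\<close>\<close>

text \<open>All structures and maps are taken from \<open>V\<close>. Finiteness is absolute for transitive models, so
  \<open>finite\<close> needs no relativization.\<close>

definition collection_of_finite_structures :: "'a hset set \<Rightarrow> 'a hset \<Rightarrow> 'a hset set \<Rightarrow> bool" where
  "collection_of_finite_structures V L K \<longleftrightarrow> class_of V K \<and>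
    (\<forall>M\<in>K. is_structure L M \<and> finite (carr M)) \<and>
    (\<forall>M\<in>K. \<forall>N\<in>V. is_structure L N \<and> (\<exists>f\<in>V. isomorphism L f M N) \<longrightarrow> N \<in> K)"

definition HP :: "'a hset set \<Rightarrow> 'a hset \<Rightarrow> 'a hset set \<Rightarrow> bool" where
  "HP V L K \<longleftrightarrow> (\<forall>M\<in>K. \<forall>N\<in>V. substructure L N M \<longrightarrow> N \<in> K)"

definition JEP :: "'a hset set \<Rightarrow> 'a hset \<Rightarrow> 'a hset set \<Rightarrow> bool" where
  "JEP V L K \<longleftrightarrow> (\<forall>M1\<in>K. \<forall>M2\<in>K. \<exists>M3\<in>K. \<exists>j1\<in>V. \<exists>j2\<in>V.
    embedding L j1 M1 M3 \<and> embedding L j2 M2 M3)"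

definition SAP :: "'a hset set \<Rightarrow> 'a hset \<Rightarrow> 'a hset set \<Rightarrow> bool" where
  "SAP V L K \<longleftrightarrow> (\<forall>M0\<in>K. \<forall>M1\<in>K. \<forall>M2\<in>K. \<forall>i1\<in>V. \<forall>i2\<in>V.
    embedding L i1 M0 M1 \<and> embedding L i2 M0 M2 \<longrightarrow>
    (\<exists>M3\<in>K. \<exists>j1\<in>V. \<exists>j2\<in>V. embedding L j1 M1 M3 \<and> embedding L j2 M2 M3 \<and>
      (\<forall>a\<in>carr M0. vapp j1 (vapp i1 a) = vapp j2 (vapp i2 a)) \<and>
      vapp j1 ` carr M1 \<inter> vapp j2 ` carr M2 = (\<lambda>a. vapp j1 (vapp i1 a)) ` carr M0))"

definition strong_Fraisse_class :: "'a hset set \<Rightarrow> 'a hset \<Rightarrow> 'a hset set \<Rightarrow> bool" where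
  "strong_Fraisse_class V L K \<longleftrightarrow>
    collection_of_finite_structures V L K \<and> HP V L K \<and> JEP V L K \<and> SAP V L K"

text \<open>Literals, with variables indexed by natural numbers.\<close>

datatype 'r literal = LRel 'r "nat list" | LEq nat nat | LNeg "'r literal"

primrec literal_of :: "'a hset \<Rightarrow> 'a hset literal \<Rightarrow> bool" where
  "literal_of L (LRel R vs) \<longleftrightarrow> R \<in> vdom L \<and> length vs = arity L R"
| "literal_of L (LEq v w) \<longleftrightarrow> True"
| "literal_of L (LNeg \<psi>) \<longleftrightarrow> literal_of L \<psi>"

primrec free_vars :: "'r literal \<Rightarrow> nat set" where
  "free_vars (LRel R vs) = set vs"
| "free_vars (LEq v w) = {v, w}"
| "free_vars (LNeg \<psi>) = free_vars \<psi>"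

definition literal_arity :: "'r literal \<Rightarrow> nat" where
  "literal_arity \<psi> = card (free_vars \<psi>)"

primrec literal_true :: "'a hset \<Rightarrow> (nat \<Rightarrow> 'a hset) \<Rightarrow> 'a hset literal \<Rightarrow> bool" where
  "literal_true M s (LRel R vs) \<longleftrightarrow> vtuple (map s vs) \<in> interp M R"
| "literal_true M s (LEq v w) \<longleftrightarrow> s v = s w"
| "literal_true M s (LNeg \<psi>) \<longleftrightarrow> \<not> literal_true M s \<psi>"

text \<open>A tuple is substituted for the free variables in increasing order of their indices.\<close>
definition holds_of :: "'a hset \<Rightarrow> 'a hset literal \<Rightarrow> 'a hset list \<Rightarrow> bool" where
  "holds_of M \<psi> as \<longleftrightarrow>
    literal_true M (\<lambda>v. the (map_of (zip (sorted_list_of_set (free_vars \<psi>)) as) v)) \<psi>"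

definition holds_of_all_distinct_tuples :: "'a hset set \<Rightarrow> 'a hset literal \<Rightarrow> bool" where
  "holds_of_all_distinct_tuples K \<psi> \<longleftrightarrow>
    (\<forall>M\<in>K. \<forall>as. length as = literal_arity \<psi> \<and> distinct as \<and> set as \<subseteq> carr M \<longrightarrow> holds_of M \<psi> as)"

definition trivial_class :: "'a hset \<Rightarrow> 'a hset set \<Rightarrow> bool" where
  "trivial_class L K \<longleftrightarrow> (\<forall>\<psi>. literal_of L \<psi> \<longrightarrow>
    holds_of_all_distinct_tuples K \<psi> \<or> holds_of_all_distinct_tuples K (LNeg \<psi>))"


section \<open>The two forcing notions\<close>

definition C_conditions :: "'a hset \<Rightarrow> 'a hset set \<Rightarrow> 'a hset set" where
  "C_conditions X K = {A\<in>K. carr A \<subseteq> elts X}"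

definition C_le :: "'a hset \<Rightarrow> 'a hset \<Rightarrow> 'a hset \<Rightarrow> bool" where
  "C_le L A B \<longleftrightarrow> substructure L B A"

definition Cohen_conditions :: "'a hset \<Rightarrow> 'a hset set" where
  "Cohen_conditions X = {p. finite (elts p) \<and> vdom p \<subseteq> elts X \<and> maps p (vdom p) {vnat 0, vnat 1}}"

definition Cohen_le :: "'a hset \<Rightarrow> 'a hset \<Rightarrow> bool" where
  "Cohen_le p q \<longleftrightarrow> elts q \<subseteq> elts p"

end

theory Submission
  imports Defs
begin

text \<open>Choose a relation \<open>R(v\<^sub>1, \<dots>, v\<^sub>m)\<close> which is not constant on injective valuations,
  with the number \<open>n\<close> of its distinct variables minimal; by JEP, \<open>n > 0\<close>. Fix distinct points
  of \<open>X\<close> for \<open>n - 1\<close> of the variables. By minimality these points carry the same structure in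
  every condition, so by SAP a condition containing them can be extended by any new point \<open>x\<close> of \<open>X\<close>
  with either truth value of \<open>R\<close> at \<open>x\<close>. Hence the truth values of \<open>R\<close> in the generic structure
  form a Cohen generic function. The filter which it generates is the value of the name consisting
  of the pairs of a canonical name for \<open>p\<close> and a condition which decides \<open>p\<close>. To see that this name
  is in \<open>V\<close>, definability over \<open>V\<close> is handled semantically, as a property of predicates on
  environments that is closed under the logical operations and definable terms.\<close>

section \<open>Predicates definable over a transitive model\<close>

text \<open>Minimality works because a tuple of the fixed points, with whatever repetitions,
  involves at most \<open>n - 1\<close> variables, so that the value of each relation on it is the
  same constant in all members of \<open>K\<close>. The fixed points can thus serve as a common base
  for amalgamating a condition with any member in which \<open>R\<close> has the desired value.
  Strongness of the amalgamation is needed because the new point must not be identified with an old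
  one. Equality literals are constant on distinct tuples, so it is a relation that witnesses
  non-triviality.

  No forcing theorem is used. Reading off the values of \<open>R\<close> is a projection of forcing
  notions, so that dense sets of Cohen conditions pull back to dense sets of structures, and the
  name is evaluated directly. The obstacle is membership in \<open>V\<close>: the class
  \<open>K\<close> is proper, amalgams come without control over their carriers, and the language
  may be infinite, so that even a structure on a finite set can be an infinite object, which has to
  be built by replacement.\<close>

primrec rename_fm :: "(nat \<Rightarrow> nat) \<Rightarrow> fm \<Rightarrow> fm" where
  "rename_fm r (FMem i j) = FMem (r i) (r j)"
| "rename_fm r (FEq i j) = FEq (r i) (r j)"
| "rename_fm r (FNeg \<phi>) = FNeg (rename_fm r \<phi>)"
| "rename_fm r (FConj \<phi> \<psi>) = FConj (rename_fm r \<phi>) (rename_fm r \<psi>)"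
| "rename_fm r (FAll \<phi>) = FAll (rename_fm (case_nat 0 (\<lambda>i. Suc (r i))) \<phi>)"

lemma range_case_nat: "range (case_nat x e) = insert x (range e)"
  by (auto simp: image_iff split: nat.split) (metis old.nat.simps(4,5))+

lemma sats_rename_fm: "sats M e (rename_fm r \<phi>) \<longleftrightarrow> sats M (\<lambda>i. e (r i)) \<phi>"
proof (induction \<phi> arbitrary: e r)
  case (FAll \<phi>)
  have "(\<lambda>i. case_nat x e (case_nat 0 (\<lambda>i. Suc (r i)) i)) = case_nat x (\<lambda>i. e (r i))" for x
    by (auto split: nat.split)
  then show ?case by (simp only: rename_fm.simps sats.simps FAll)
qed auto

text \<open>Interleaving leaves infinitely many positions to each sequence, so that a formula may
  use any number of variables next to its parameters, and two parameter sequences can in turn be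
  merged into one.\<close>

definition merge :: "(nat \<Rightarrow> 'b) \<Rightarrow> (nat \<Rightarrow> 'b) \<Rightarrow> nat \<Rightarrow> 'b" where
  "merge e c i = (if even i then e (i div 2) else c (i div 2))"

lemma merge_simps [simp]: "merge e c (2 * i) = e i" "merge e c (Suc (2 * i)) = c i"
  by (simp_all add: merge_def)

lemma range_merge: "range (merge e c) = range e \<union> range c"
proof -
  have "e i \<in> range (merge e c)" "c i \<in> range (merge e c)" for i
    using merge_simps[of e c i] by (metis rangeI)+
  then show ?thesis by (auto simp: merge_def)
qed

text \<open>The values of \<open>c\<close> at the odd positions of the environment are the parameters.\<close>
definition dfn :: "'a hset set \<Rightarrow> ((nat \<Rightarrow> 'a hset) \<Rightarrow> bool) \<Rightarrow> bool" where
  "dfn V P \<longleftrightarrow> (\<exists>\<phi> c. range c \<subseteq> V \<and> (\<forall>e. range e \<subseteq> V \<longrightarrow> (P e \<longleftrightarrow> sats V (merge e c) \<phi>)))"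

text \<open>A function is given by its graph, with the value at position 0 and the arguments moved
  up by one. The values have to lie in \<open>V\<close>, so that a quantifier over \<open>V\<close>
  can bind them.\<close>

definition dfn_tm :: "'a hset set \<Rightarrow> ((nat \<Rightarrow> 'a hset) \<Rightarrow> 'a hset) \<Rightarrow> bool" where
  "dfn_tm V t \<longleftrightarrow> (\<forall>e. range e \<subseteq> V \<longrightarrow> t e \<in> V) \<and> dfn V (\<lambda>e. e 0 = t (\<lambda>i. e (Suc i)))"

lemma dfn_cong:
  assumes "dfn V Q" "\<And>e. range e \<subseteq> V \<Longrightarrow> P e \<longleftrightarrow> Q e"
  shows "dfn V P"
  using assms unfolding dfn_def by metis

lemma dfn_rename:
  assumes "dfn V P" shows "dfn V (\<lambda>e. P (\<lambda>i. e (r i)))"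
proof -
  obtain \<phi> c where c: "range c \<subseteq> V" and \<phi>: "\<And>e. range e \<subseteq> V \<Longrightarrow> P e \<longleftrightarrow> sats V (merge e c) \<phi>"
    using assms unfolding dfn_def by blast
  \<comment> \<open>Only the even positions are renamed; the parameters at the odd positions stay in
    place.\<close>
  let ?r = "\<lambda>i. if even i then 2 * r (i div 2) else i"
  have "(\<lambda>i. merge e c (?r i)) = merge (\<lambda>i. e (r i)) c" for e
    by (auto simp: fun_eq_iff merge_def)
  then have "P (\<lambda>i. e (r i)) \<longleftrightarrow> sats V (merge e c) (rename_fm ?r \<phi>)" if "range e \<subseteq> V" for e
    using \<phi>[of "\<lambda>i. e (r i)"] that by (auto simp: sats_rename_fm)
  with c show ?thesis unfolding dfn_def by blast
qed

lemma dfn_not: "dfn V P \<Longrightarrow> dfn V (\<lambda>e. \<not> P e)"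
  unfolding dfn_def by (metis sats.simps(3))

lemma dfn_conj:
  assumes "dfn V P" "dfn V Q" shows "dfn V (\<lambda>e. P e \<and> Q e)"
proof -
  obtain \<phi> c where c: "range c \<subseteq> V" and \<phi>: "\<And>e. range e \<subseteq> V \<Longrightarrow> P e \<longleftrightarrow> sats V (merge e c) \<phi>"
    using assms(1) unfolding dfn_def by blast
  obtain \<psi> d where d: "range d \<subseteq> V" and \<psi>: "\<And>e. range e \<subseteq> V \<Longrightarrow> Q e \<longleftrightarrow> sats V (merge e d) \<psi>"
    using assms(2) unfolding dfn_def by blast
  \<comment> \<open>The joint parameters are \<open>merge c d\<close>: \<open>?r\<close> redirects
    the parameter \<open>c k\<close> to index \<open>2 * k\<close> of this sequence, and
    \<open>?s\<close> redirects \<open>d k\<close> to index \<open>Suc (2 * k)\<close>.\<close>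
  let ?r = "\<lambda>i. if even i then i else Suc (2 * (2 * (i div 2)))"
  let ?s = "\<lambda>i. if even i then i else Suc (2 * Suc (2 * (i div 2)))"
  have "merge e (merge c d) (Suc (2 * Suc (2 * i))) = d i" for e i
    unfolding merge_simps ..
  then have "(\<lambda>i. merge e (merge c d) (?r i)) = merge e c" "(\<lambda>i. merge e (merge c d) (?s i)) = merge e d" for e
    by (auto simp: fun_eq_iff elim!: evenE oddE)
  then have "P e \<and> Q e \<longleftrightarrow> sats V (merge e (merge c d)) (FConj (rename_fm ?r \<phi>) (rename_fm ?s \<psi>))"
    if "range e \<subseteq> V" for e
    using \<phi>[OF that] \<psi>[OF that] by (simp add: sats_rename_fm)
  moreover have "range (merge c d) \<subseteq> V" using c d by (simp add: range_merge)
  ultimately show ?thesis unfolding dfn_def by blast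
qed

text \<open>A quantifier prefixes its value to the whole merged environment, whereas it should be
  prefixed to the variables alone. To compensate, the even positions other than 0 move down by one
  and the odd ones move up by one.\<close>

definition unshift :: "nat \<Rightarrow> nat" where
  "unshift i = (if i = 0 then 0 else if even i then i - 1 else Suc i)"

lemma merge_case_nat:
  "merge (case_nat x e) c = (\<lambda>i. case_nat x (merge e c) (unshift i))"
proof
  fix i
  consider (zero) "i = 0" | (even) j where "i = 2 * Suc j" | (odd) j where "i = Suc (2 * j)"
    by (metis evenE oddE not0_implies_Suc mult_0_right Suc_eq_plus1)
  then show "merge (case_nat x e) c i = case_nat x (merge e c) (unshift i)"
  proof cases
    case even
    then have "unshift i = Suc (2 * j)" by (simp add: unshift_def)
    then show ?thesis unfolding even merge_simps by simp
  next
    case odd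
    then have "unshift i = Suc (Suc (2 * j))" by (simp add: unshift_def)
    then show ?thesis unfolding odd by simp
  qed (simp add: unshift_def merge_def)
qed

lemma dfn_all:
  assumes "dfn V (\<lambda>e. R (e 0) (\<lambda>i. e (Suc i)))" shows "dfn V (\<lambda>e. \<forall>x\<in>V. R x e)"
proof -
  obtain \<phi> c where c: "range c \<subseteq> V"
    and \<phi>: "\<And>e. range e \<subseteq> V \<Longrightarrow> R (e 0) (\<lambda>i. e (Suc i)) \<longleftrightarrow> sats V (merge e c) \<phi>"
    using assms unfolding dfn_def by blast
  let ?r = unshift
  have "R x e \<longleftrightarrow> sats V (case_nat x (merge e c)) (rename_fm ?r \<phi>)" if "range e \<subseteq> V" "x \<in> V" for x e
  proof -
    have "range (case_nat x e) \<subseteq> V" using that by (simp add: range_case_nat)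
    from \<phi>[OF this] show ?thesis by (simp add: sats_rename_fm merge_case_nat)
  qed
  then have "(\<forall>x\<in>V. R x e) \<longleftrightarrow> sats V (merge e c) (FAll (rename_fm ?r \<phi>))" if "range e \<subseteq> V" for e
    using that by simp
  with c show ?thesis unfolding dfn_def by blast
qed

lemma dfn_disj:
  assumes "dfn V P" "dfn V Q" shows "dfn V (\<lambda>e. P e \<or> Q e)"
proof (rule dfn_cong)
  show "dfn V (\<lambda>e. \<not> (\<not> P e \<and> \<not> Q e))"
    by (intro dfn_not dfn_conj assms)
qed auto

lemma dfn_imp:
  assumes "dfn V P" "dfn V Q" shows "dfn V (\<lambda>e. P e \<longrightarrow> Q e)"
proof (rule dfn_cong)
  show "dfn V (\<lambda>e. \<not> (P e \<and> \<not> Q e))"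
    by (intro dfn_not dfn_conj assms)
qed auto

lemma dfn_iff:
  assumes "dfn V P" "dfn V Q" shows "dfn V (\<lambda>e. P e \<longleftrightarrow> Q e)"
proof (rule dfn_cong)
  show "dfn V (\<lambda>e. \<not> (P e \<and> \<not> Q e) \<and> \<not> (Q e \<and> \<not> P e))"
    by (intro dfn_not dfn_conj assms)
qed auto

lemma dfn_ex:
  assumes "dfn V (\<lambda>e. R (e 0) (\<lambda>i. e (Suc i)))" shows "dfn V (\<lambda>e. \<exists>x\<in>V. R x e)"
proof (rule dfn_cong)
  show "dfn V (\<lambda>e. \<not> (\<forall>x\<in>V. \<not> R x e))"
    by (intro dfn_not dfn_all assms)
qed simp

lemma dfn_tm_in: "dfn_tm V t \<Longrightarrow> range e \<subseteq> V \<Longrightarrow> t e \<in> V"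
  unfolding dfn_tm_def by blast

text \<open>Formulas have no terms, so a term is replaced by a quantifier over \<open>V\<close> that
  binds its value.\<close>

lemma dfn_subst:
  assumes R: "dfn V (\<lambda>e. R (e 0) (\<lambda>i. e (Suc i)))" and t: "dfn_tm V t"
  shows "dfn V (\<lambda>e. R (t e) e)"
proof (rule dfn_cong)
  show "dfn V (\<lambda>e. \<exists>x\<in>V. x = t e \<and> R x e)"
    using t R unfolding dfn_tm_def by (intro dfn_ex dfn_conj) auto
qed (auto intro: dfn_tm_in[OF t])

lemma dfn_tm_shift: "dfn_tm V t \<Longrightarrow> dfn_tm V (\<lambda>e. t (\<lambda>i. e (Suc i)))"
  unfolding dfn_tm_def
  using dfn_rename[of V "\<lambda>e. e 0 = t (\<lambda>i. e (Suc i))" "case_nat 0 (\<lambda>i. Suc (Suc i))"]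
  by (simp add: image_subset_iff)

lemma dfn_subst2:
  assumes R: "dfn V (\<lambda>e. R (e 0) (e 1))" and t: "dfn_tm V t" and u: "dfn_tm V u"
  shows "dfn V (\<lambda>e. R (t e) (u e))"
proof (rule dfn_subst[OF _ t])
  show "dfn V (\<lambda>e. R (e 0) (u (\<lambda>i. e (Suc i))))"
  proof (rule dfn_subst[OF _ dfn_tm_shift[OF u]])
    show "dfn V (\<lambda>e. R (e (Suc 0)) (e 0))"
      using dfn_rename[OF R, of "\<lambda>i. if i = 0 then 1 else 0"] by simp
  qed
qed

lemma elts_vset_finite: "finite S \<Longrightarrow> elts (vset S) = (S :: 'a hset set)"
  by (simp add: elts_vset_countable countable_finite)

section \<open>Closure properties of a transitive model\<close>

locale transitive_model =
  fixes V :: "'a hset set"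
  assumes model: "model_of_set_theory V"
begin

lemma elts_subset: "x \<in> V \<Longrightarrow> elts x \<subseteq> V"
  using model unfolding model_of_set_theory_def by blast

lemma elts_in: "y \<in> elts x \<Longrightarrow> x \<in> V \<Longrightarrow> y \<in> V"
  using elts_subset by blast

lemma zfc: "pairing V" "union_axiom V" "power_set V" "infinity V" "separation V" "replacement V"
  using model unfolding model_of_set_theory_def ZFC_def by auto

lemma V_nonempty: "\<exists>x. x \<in> V"
  using zfc(4) unfolding infinity_def by blast

lemma dfn_mem_var: "dfn V (\<lambda>e. e i \<in> elts (e j))"
proof -
  obtain c where "c \<in> V" using V_nonempty by blast
  then show ?thesis
    unfolding dfn_def by (intro exI[of _ "FMem (2 * i) (2 * j)"] exI[of _ "\<lambda>_. c"]) auto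
qed

lemma dfn_eq_var: "dfn V (\<lambda>e. e i = e j)"
proof -
  obtain c where "c \<in> V" using V_nonempty by blast
  then show ?thesis
    unfolding dfn_def by (intro exI[of _ "FEq (2 * i) (2 * j)"] exI[of _ "\<lambda>_. c"]) auto
qed

lemma dfn_tm_var: "dfn_tm V (\<lambda>e. e i)"
  unfolding dfn_tm_def using dfn_eq_var[of 0 "Suc i"] by auto

lemma dfn_tm_const: "c \<in> V \<Longrightarrow> dfn_tm V (\<lambda>e. c)"
  unfolding dfn_tm_def dfn_def
proof (intro conjI allI impI exI[of _ "FEq 0 (Suc (2 * 0))"] exI[of _ "\<lambda>_. c"])
  fix e :: "nat \<Rightarrow> 'a hset"
  show "(e 0 = c) \<longleftrightarrow> sats V (merge e (\<lambda>_. c)) (FEq 0 (Suc (2 * 0)))"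
    by (simp add: merge_def)
qed auto

lemma dfn_mem: "dfn_tm V t \<Longrightarrow> dfn_tm V u \<Longrightarrow> dfn V (\<lambda>e. t e \<in> elts (u e))"
  by (rule dfn_subst2[where R = "\<lambda>x y. x \<in> elts y", OF dfn_mem_var[of 0 1]])

lemma dfn_eq: "dfn_tm V t \<Longrightarrow> dfn_tm V u \<Longrightarrow> dfn V (\<lambda>e. t e = u e)"
  by (rule dfn_subst2[where R = "(=)", OF dfn_eq_var[of 0 1]])

lemma dfn_ball:
  assumes "dfn_tm V t" "dfn V (\<lambda>e. R (e 0) (\<lambda>i. e (Suc i)))"
  shows "dfn V (\<lambda>e. \<forall>x\<in>elts (t e). R x e)"
proof (rule dfn_cong)
  show "dfn V (\<lambda>e. \<forall>x\<in>V. x \<in> elts (t e) \<longrightarrow> R x e)"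
    by (intro dfn_all dfn_imp dfn_mem dfn_tm_var assms dfn_tm_shift[OF assms(1)])
qed (use elts_in dfn_tm_in[OF assms(1)] in blast)

lemma dfn_bex:
  assumes "dfn_tm V t" "dfn V (\<lambda>e. R (e 0) (\<lambda>i. e (Suc i)))"
  shows "dfn V (\<lambda>e. \<exists>x\<in>elts (t e). R x e)"
proof (rule dfn_cong)
  show "dfn V (\<lambda>e. \<exists>x\<in>V. x \<in> elts (t e) \<and> R x e)"
    by (intro dfn_ex dfn_conj dfn_mem dfn_tm_var assms dfn_tm_shift[OF assms(1)])
qed (use elts_in dfn_tm_in[OF assms(1)] in blast)

text \<open>By transitivity, sets of \<open>V\<close> are compared through their elements in
  \<open>V\<close>, so an equation with an explicit set becomes a condition relativized to
  \<open>V\<close>. The premise \<open>elts (vset S) = S\<close> says that \<open>S\<close> is small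
  enough to be a set.\<close>

lemma eq_vset_iff:
  assumes "x \<in> V" "S \<subseteq> V" "elts (vset S) = S"
  shows "x = vset S \<longleftrightarrow> (\<forall>z\<in>V. z \<in> elts x \<longleftrightarrow> z \<in> S)"
proof
  assume "\<forall>z\<in>V. z \<in> elts x \<longleftrightarrow> z \<in> S"
  then have "elts x = S" using assms elts_in by blast
  then show "x = vset S" by (metis vset_elts)
qed (use assms in auto)

lemma elts_doubleton: "elts (vset {a, b :: 'a hset}) = {a, b}"
  by (simp add: elts_vset_countable)

lemma doubleton_in:
  assumes "a \<in> V" "b \<in> V" shows "vset {a, b} \<in> V"
proof -
  obtain u where "u \<in> V" "\<forall>z\<in>V. z \<in> elts u \<longleftrightarrow> z = a \<or> z = b"
    using zfc(1) assms unfolding pairing_def by blast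
  then have "u = vset {a, b}"
    using assms by (subst eq_vset_iff) (auto simp: elts_doubleton)
  with \<open>u \<in> V\<close> show ?thesis by simp
qed

lemma vpair_in: "a \<in> V \<Longrightarrow> b \<in> V \<Longrightarrow> vpair a b \<in> V"
  using doubleton_in[of a a] unfolding vpair_def by (auto intro: doubleton_in)

lemma dfn_tm_doubleton:
  assumes "dfn_tm V t" "dfn_tm V u" shows "dfn_tm V (\<lambda>e. vset {t e, u e})"
  unfolding dfn_tm_def
proof (intro conjI allI impI)
  show "dfn V (\<lambda>e. e 0 = vset {t (\<lambda>i. e (Suc i)), u (\<lambda>i. e (Suc i))})"
  proof (rule dfn_cong)
    show "dfn V (\<lambda>e. \<forall>z\<in>V. z \<in> elts (e 0) \<longleftrightarrow> z = t (\<lambda>i. e (Suc i)) \<or> z = u (\<lambda>i. e (Suc i)))"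
      by (intro dfn_all dfn_iff dfn_disj dfn_mem dfn_eq dfn_tm_var assms[THEN dfn_tm_shift, THEN dfn_tm_shift])
    fix e :: "nat \<Rightarrow> 'a hset"
    assume e: "range e \<subseteq> V"
    then have "range (\<lambda>i. e (Suc i)) \<subseteq> V" "e 0 \<in> V" by auto
    then show "e 0 = vset {t (\<lambda>i. e (Suc i)), u (\<lambda>i. e (Suc i))} \<longleftrightarrow>
        (\<forall>z\<in>V. z \<in> elts (e 0) \<longleftrightarrow> z = t (\<lambda>i. e (Suc i)) \<or> z = u (\<lambda>i. e (Suc i)))"
      using assms by (subst eq_vset_iff) (auto simp: elts_doubleton dfn_tm_in)
  qed
  fix e :: "nat \<Rightarrow> 'a hset"
  assume "range e \<subseteq> V"
  then show "vset {t e, u e} \<in> V" using assms by (simp add: doubleton_in dfn_tm_in)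
qed

lemma dfn_tm_vpair:
  assumes "dfn_tm V t" "dfn_tm V u" shows "dfn_tm V (\<lambda>e. vpair (t e) (u e))"
proof -
  have "dfn_tm V (\<lambda>e. vset {vset {t e, t e}, vset {t e, u e}})"
    by (intro dfn_tm_doubleton assms)
  then show ?thesis by (simp add: vpair_def)
qed

lemmas dfn_intros = dfn_not dfn_conj dfn_disj dfn_imp dfn_iff dfn_all dfn_ex dfn_ball dfn_bex
  dfn_mem dfn_eq dfn_tm_var dfn_tm_const dfn_tm_vpair

lemma separation_dfn:
  assumes "a \<in> V" "dfn V (\<lambda>e. R (e 0))"
  shows "\<exists>u\<in>V. elts u = {x \<in> elts a. R x}"
proof -
  obtain \<phi> c where c: "range c \<subseteq> V" and \<phi>: "\<And>e. range e \<subseteq> V \<Longrightarrow> R (e 0) \<longleftrightarrow> sats V (merge e c) \<phi>"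
    using assms unfolding dfn_def by blast
  let ?r = unshift
  \<comment> \<open>\<open>R\<close> looks at position 0 only; the first copy of \<open>c\<close>
    fills the other variable positions with arbitrary elements of \<open>V\<close>.\<close>
  have e: "range (merge c c) \<subseteq> V" using c by (simp add: range_merge)
  obtain u where u: "u \<in> V"
    "\<And>x. x \<in> V \<Longrightarrow> x \<in> elts u \<longleftrightarrow> x \<in> elts a \<and> sats V (case_nat x (merge c c)) (rename_fm ?r \<phi>)"
    using zfc(5)[unfolded separation_def, rule_format, OF e assms(1), of "rename_fm ?r \<phi>"] by blast
  moreover have "sats V (case_nat x (merge c c)) (rename_fm ?r \<phi>) \<longleftrightarrow> R x" if "x \<in> V" for x
  proof -
    have "range (case_nat x c) \<subseteq> V" using c that by (simp add: range_case_nat)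
    from \<phi>[OF this] show ?thesis by (simp add: sats_rename_fm merge_case_nat)
  qed
  ultimately have "elts u = {x \<in> elts a. R x}"
    using elts_in assms(1) by blast
  with u show ?thesis by blast
qed

lemma replacement_dfn:
  assumes "a \<in> V" "dfn V (\<lambda>e. R (e 0) (e (Suc 0)))"
    and "\<And>x y z. x \<in> elts a \<Longrightarrow> y \<in> V \<Longrightarrow> z \<in> V \<Longrightarrow> R x y \<Longrightarrow> R x z \<Longrightarrow> y = z"
  shows "\<exists>u\<in>V. elts u = {y \<in> V. \<exists>x\<in>elts a. R x y}"
proof -
  obtain \<phi> c where c: "range c \<subseteq> V"
    and \<phi>: "\<And>e. range e \<subseteq> V \<Longrightarrow> R (e 0) (e (Suc 0)) \<longleftrightarrow> sats V (merge e c) \<phi>"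
    using assms unfolding dfn_def by blast
  let ?r = unshift
  \<comment> \<open>Two values are prefixed here. \<open>?r'\<close> is \<open>unshift\<close> below
    the prefix \<open>x\<close> and accounts for \<open>y\<close>; \<open>?r\<close> accounts for
    \<open>x\<close>.\<close>
  let ?r' = "case_nat 0 (\<lambda>i. Suc (?r i))"
  define \<psi> where "\<psi> = rename_fm ?r' (rename_fm ?r \<phi>)"
  define e where "e = merge c c"
  have e: "range e \<subseteq> V" using c by (simp add: range_merge e_def)
  have *: "sats V (case_nat x (case_nat y e)) \<psi> \<longleftrightarrow> R x y" if "x \<in> V" "y \<in> V" for x y
  proof -
    have "range (case_nat x (case_nat y c)) \<subseteq> V" using c that by (simp add: range_case_nat)
    note \<phi>[OF this]
    moreover have r: "(\<lambda>i. case_nat x (case_nat y e) (?r' i)) = case_nat x (merge (case_nat y c) c)"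
      by (auto simp: fun_eq_iff e_def merge_case_nat[of y] split: nat.split)
    have "(\<lambda>i. case_nat x (case_nat y e) (?r' (?r i))) = merge (case_nat x (case_nat y c)) c"
      unfolding merge_case_nat[of x "case_nat y c" c] by (rule ext) (rule fun_cong[OF r])
    ultimately show ?thesis
      unfolding \<psi>_def sats_rename_fm by simp
  qed
  have "\<exists>u\<in>V. \<forall>y\<in>V. y \<in> elts u \<longleftrightarrow> (\<exists>x\<in>V. x \<in> elts a \<and> sats V (case_nat x (case_nat y e)) \<psi>)"
  proof (rule zfc(6)[unfolded replacement_def, rule_format, OF e assms(1)])
    fix x y z assume "x \<in> V" "x \<in> elts a" "y \<in> V" "z \<in> V"
      "sats V (case_nat x (case_nat y e)) \<psi> \<and> sats V (case_nat x (case_nat z e)) \<psi>"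
    then show "y = z" using assms(3)[of x y z] by (simp add: *)
  qed
  then obtain u where u: "u \<in> V"
    "\<forall>y\<in>V. y \<in> elts u \<longleftrightarrow> (\<exists>x\<in>V. x \<in> elts a \<and> sats V (case_nat x (case_nat y e)) \<psi>)" by blast
  then have "elts u = {y \<in> V. \<exists>x\<in>elts a. R x y}"
    using elts_in assms(1) * by (auto; blast)
  with u show ?thesis by blast
qed

lemma Union_in:
  assumes "a \<in> V" shows "\<exists>u\<in>V. elts u = (\<Union>x\<in>elts a. elts x)"
proof -
  obtain u where "u \<in> V" "\<forall>z\<in>V. z \<in> elts u \<longleftrightarrow> (\<exists>y\<in>V. y \<in> elts a \<and> z \<in> elts y)"
    using zfc(2) assms unfolding union_axiom_def by blast
  then have "elts u = (\<Union>x\<in>elts a. elts x)" using elts_in assms by (auto; blast)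
  with \<open>u \<in> V\<close> show ?thesis by blast
qed

lemma Pow_in:
  assumes "a \<in> V" shows "\<exists>u\<in>V. elts u = {y \<in> V. elts y \<subseteq> elts a}"
proof -
  obtain u where u: "u \<in> V" "\<forall>z\<in>V. z \<in> elts u \<longleftrightarrow> (\<forall>y\<in>V. y \<in> elts z \<longrightarrow> y \<in> elts a)"
    using zfc(3) assms unfolding power_set_def by blast
  then have "elts u = {y \<in> V. elts y \<subseteq> elts a}" using elts_in by (auto; blast)
  with u show ?thesis by blast
qed

lemma Un_in:
  assumes "a \<in> V" "b \<in> V" shows "\<exists>u\<in>V. elts u = elts a \<union> elts b"
  using Union_in[OF doubleton_in[OF assms]] by (simp add: elts_doubleton)

lemma insert_in:
  assumes "a \<in> V" "b \<in> V" shows "\<exists>u\<in>V. elts u = insert a (elts b)"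
  using Un_in[OF doubleton_in[OF assms(1) assms(1)] assms(2)] unfolding elts_doubleton by simp

lemma empty_in: "vset {} \<in> V"
proof -
  obtain z where "z \<in> V" "\<forall>y\<in>V. y \<notin> elts z" using zfc(4) unfolding infinity_def by blast
  then have "elts z = {}" using elts_in by blast
  with \<open>z \<in> V\<close> show ?thesis by (metis vset_elts)
qed

lemma finite_in: "finite S \<Longrightarrow> S \<subseteq> V \<Longrightarrow> vset S \<in> V"
proof (induction S rule: finite_induct)
  case (insert x S)
  then obtain u where "u \<in> V" "elts u = insert x S"
    using insert_in[of x "vset S"] by (auto simp: elts_vset_finite)
  then show ?case by (metis vset_elts)
qed (simp add: empty_in)

text \<open>A Kuratowski pair is a set of subsets of \<open>a \<union> b\<close>, hence an element
  of the double power set. A superset of the product is enough as a bound for separation.\<close>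

lemma ex_product_bound:
  assumes "a \<in> V" "b \<in> V"
  shows "\<exists>c\<in>V. \<forall>x\<in>elts a. \<forall>y\<in>elts b. vpair x y \<in> elts c"
proof -
  obtain u where u: "u \<in> V" "elts u = elts a \<union> elts b" using Un_in[OF assms] by blast
  obtain v where v: "v \<in> V" "elts v = {y \<in> V. elts y \<subseteq> elts u}" using Pow_in[OF u(1)] by blast
  obtain w where w: "w \<in> V" "elts w = {y \<in> V. elts y \<subseteq> elts v}" using Pow_in[OF v(1)] by blast
  have "vpair x y \<in> elts w" if "x \<in> elts a" "y \<in> elts b" for x y
  proof -
    have V: "x \<in> V" "y \<in> V" using that assms elts_in by blast+
    then have "vset {x, x} \<in> elts v" "vset {x, y} \<in> elts v"
      using that doubleton_in[of x] u V unfolding v by (auto simp only: elts_doubleton)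
    then have "elts (vpair x y) \<subseteq> elts v" unfolding vpair_def by (simp add: elts_doubleton)
    then show ?thesis using V by (simp add: w vpair_in)
  qed
  with w show ?thesis by blast
qed

lemma vpair_elts_in:
  assumes "vpair a b \<in> V" shows "a \<in> V" "b \<in> V"
proof -
  have "vset {a, b} \<in> elts (vpair a b)" unfolding vpair_def by (simp add: elts_doubleton)
  then have "vset {a, b} \<in> V" using assms elts_in by blast
  then show "a \<in> V" "b \<in> V" using elts_in elts_doubleton by blast+
qed

lemma vpair_mem_in:
  assumes "vpair a b \<in> elts f" "f \<in> V" shows "a \<in> V" "b \<in> V"
  using assms elts_in vpair_elts_in by blast+

end


section \<open>Functions, tuples and pullbacks of structures\<close>

lemma vapp_eqI: "is_fun f \<Longrightarrow> vpair a b \<in> elts f \<Longrightarrow> vapp f a = b"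
  unfolding vapp_def is_fun_def by (rule the_equality) blast+

lemma vpair_vapp: "is_fun f \<Longrightarrow> a \<in> vdom f \<Longrightarrow> vpair a (vapp f a) \<in> elts f"
  unfolding vdom_def using vapp_eqI by fastforce

lemma vfst_vpair [simp]: "vfst (vpair a b) = a"
  unfolding vfst_def by auto

lemma vsnd_vpair [simp]: "vsnd (vpair a b) = b"
  unfolding vsnd_def by auto

lemma is_fun_ext:
  assumes "is_fun f" "is_fun g" "vdom f = vdom g" "\<And>a. a \<in> vdom f \<Longrightarrow> vapp f a = vapp g a"
  shows "f = g"
proof -
  have *: "elts f \<subseteq> elts g"
    if fg: "is_fun f" "is_fun g" "vdom f = vdom g" "\<And>a. a \<in> vdom f \<Longrightarrow> vapp f a = vapp g a" for f g :: "'a hset"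
  proof
    fix z assume z: "z \<in> elts f"
    then obtain a b where ab: "z = vpair a b" using fg(1) unfolding is_fun_def by blast
    then have "a \<in> vdom f" using z unfolding vdom_def by blast
    then have "vpair a (vapp g a) \<in> elts g" "vapp g a = b"
      using fg vpair_vapp vapp_eqI z ab by (metis, metis)
    then show "z \<in> elts g" using ab by simp
  qed
  show ?thesis using *[OF assms] *[OF assms(2,1)] assms by (intro hset_ext) auto
qed

definition fgraph :: "('a hset \<Rightarrow> 'a hset) \<Rightarrow> 'a hset set \<Rightarrow> 'a hset" where
  "fgraph h S = vset ((\<lambda>x. vpair x (h x)) ` S)"

lemma elts_fgraph: "finite S \<Longrightarrow> elts (fgraph h S) = (\<lambda>x. vpair x (h x)) ` S"
  unfolding fgraph_def by (simp add: elts_vset_finite)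

lemma is_fun_fgraph: "finite S \<Longrightarrow> is_fun (fgraph h S)"
  by (auto simp: is_fun_def elts_fgraph)

lemma vdom_fgraph: "finite S \<Longrightarrow> vdom (fgraph h S) = S"
  by (auto simp: vdom_def elts_fgraph)

lemma vapp_fgraph: "finite S \<Longrightarrow> x \<in> S \<Longrightarrow> vapp (fgraph h S) x = h x"
  by (rule vapp_eqI) (auto simp: is_fun_fgraph elts_fgraph)

lemma maps_fgraph: "finite S \<Longrightarrow> maps (fgraph h S) S T \<longleftrightarrow> h ` S \<subseteq> T"
  by (auto simp: maps_def is_fun_fgraph vdom_fgraph vapp_fgraph)

lemma elts_vnat: "elts (vnat n :: 'a hset) = vnat ` {..<n}"
proof (induction n)
  case (Suc n)
  have "elts (vnat (Suc n) :: 'a hset) = insert (vnat n) (elts (vnat n))"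
    by (simp add: elts_vset_finite Suc)
  then show ?case by (simp add: Suc lessThan_Suc)
qed (simp add: elts_vset_finite)

lemma vnat_inject [simp]: "(vnat m :: 'a hset) = vnat n \<longleftrightarrow> m = n"
proof -
  have "(vnat m :: 'a hset) \<noteq> vnat n" if "m < n" for m n
  proof
    assume "(vnat m :: 'a hset) = vnat n"
    moreover have "(vnat m :: 'a hset) \<in> elts (vnat n)" using that by (simp add: elts_vnat)
    ultimately have "(vnat n :: 'a hset, vnat n) \<in> {(x, y). x \<in> elts y}" by simp
    then show False using wf_not_refl[OF wf_elts] by blast
  qed
  then show ?thesis by (metis linorder_neqE_nat)
qed

lemma elts_vtuple: "elts (vtuple as) = {vpair (vnat i) (as ! i) | i. i < length as}"
  unfolding vtuple_def by (rule elts_vset_finite) simp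

lemma is_fun_vtuple: "is_fun (vtuple as)"
  by (auto simp: is_fun_def elts_vtuple)

lemma vdom_vtuple: "vdom (vtuple as) = elts (vnat (length as))"
  by (auto simp: vdom_def elts_vtuple elts_vnat)

lemma vapp_vtuple: "i < length as \<Longrightarrow> vapp (vtuple as) (vnat i) = as ! i"
  by (rule vapp_eqI) (auto simp: is_fun_vtuple elts_vtuple)

lemma vtuples_eq: "vtuples n A = vtuple ` {as. length as = n \<and> set as \<subseteq> A}"
proof (intro equalityI subsetI)
  fix t assume "t \<in> vtuples n A"
  then have t: "is_fun t" "vdom t = elts (vnat n)" "\<forall>a\<in>elts (vnat n). vapp t a \<in> A"
    by (auto simp: vtuples_def maps_def)
  let ?as = "map (\<lambda>i. vapp t (vnat i)) [0..<n]"
  have "t = vtuple ?as"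
    by (rule is_fun_ext) (auto simp: t is_fun_vtuple vdom_vtuple elts_vnat vapp_vtuple)
  moreover have "length ?as = n" "set ?as \<subseteq> A" using t by (auto simp: elts_vnat)
  ultimately show "t \<in> vtuple ` {as. length as = n \<and> set as \<subseteq> A}" by blast
next
  fix t assume "t \<in> vtuple ` {as. length as = n \<and> set as \<subseteq> A}"
  then show "t \<in> vtuples n A"
    by (auto simp: vtuples_def maps_def is_fun_vtuple vdom_vtuple elts_vnat vapp_vtuple)
qed

text \<open>\<open>n\<close> is a number of the metatheory, so the formula is built by recursion on
  it; the empty disjunction is the negation of an identity.\<close>

lemma dfn_finite_disj:
  fixes n :: nat
  assumes "model_of_set_theory V" "\<And>i. i < n \<Longrightarrow> dfn V (P i)"
  shows "dfn V (\<lambda>e. \<exists>i<n. P i e)"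
  using assms(2)
proof (induction n)
  case 0
  interpret transitive_model V by unfold_locales (rule assms)
  show ?case by (rule dfn_cong[OF dfn_not[OF dfn_eq_var[of 0 0]]]) simp
next
  case (Suc n)
  then have "dfn V (\<lambda>e. (\<exists>i<n. P i e) \<or> P n e)" by (intro dfn_disj) auto
  then show ?case by (rule dfn_cong) (auto simp: less_Suc_eq)
qed

context transitive_model
begin

lemma vnat_in: "vnat n \<in> V"
proof (induction n)
  case (Suc n)
  then show ?case using insert_in[of "vnat n" "vnat n"] by (auto, metis vset_elts)
qed (simp add: empty_in)

text \<open>The inductive set given by the axiom may have further elements, but it bounds the
  indices of all tuples.\<close>

lemma ex_omega_bound: "\<exists>w\<in>V. range vnat \<subseteq> elts w"
proof -
  obtain w where w: "w \<in> V" "\<exists>z\<in>V. z \<in> elts w \<and> (\<forall>y\<in>V. y \<notin> elts z)"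
    "\<forall>x\<in>V. x \<in> elts w \<longrightarrow> (\<exists>s\<in>V. s \<in> elts w \<and> (\<forall>z\<in>V. z \<in> elts s \<longleftrightarrow> z \<in> elts x \<or> z = x))"
    using zfc(4) unfolding infinity_def by blast
  have "vnat n \<in> elts w" for n
  proof (induction n)
    case 0
    obtain z where z: "z \<in> V" "z \<in> elts w" "\<forall>y\<in>V. y \<notin> elts z" using w(2) by blast
    then have "elts z = {}" using elts_in by blast
    then show ?case using z by (metis vnat.simps(1) vset_elts)
  next
    case (Suc n)
    then obtain s where s: "s \<in> V" "s \<in> elts w" "\<forall>z\<in>V. z \<in> elts s \<longleftrightarrow> z \<in> elts (vnat n) \<or> z = vnat n"
      using w(3) vnat_in by blast
    then have "elts s = insert (vnat n) (elts (vnat n))"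
      using elts_in vnat_in[of n] by blast
    then have "s = vnat (Suc n)" by (metis vnat.simps(2) vset_elts)
    then show ?case using s by simp
  qed
  then show ?thesis using w by blast
qed

lemma fgraph_in: "finite S \<Longrightarrow> S \<subseteq> V \<Longrightarrow> h ` S \<subseteq> V \<Longrightarrow> fgraph h S \<in> V"
  unfolding fgraph_def by (rule finite_in) (auto intro!: vpair_in)

lemma vtuple_in: "set as \<subseteq> V \<Longrightarrow> vtuple as \<in> V"
  unfolding vtuple_def by (rule finite_in) (auto intro!: vpair_in vnat_in)

lemma dfn_tm_vtuple:
  assumes "\<And>v. v \<in> set vs \<Longrightarrow> dfn_tm V (g v)"
  shows "dfn_tm V (\<lambda>e. vtuple (map (\<lambda>v. g v e) vs))"
  unfolding dfn_tm_def
proof (intro conjI allI impI)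
  fix e :: "nat \<Rightarrow> 'a hset" assume "range e \<subseteq> V"
  then show "vtuple (map (\<lambda>v. g v e) vs) \<in> V"
    using dfn_tm_in[OF assms] by (intro vtuple_in) auto
next
  show "dfn V (\<lambda>e. e 0 = vtuple (map (\<lambda>v. g v (\<lambda>i. e (Suc i))) vs))"
  proof (rule dfn_cong)
    show "dfn V (\<lambda>e. \<forall>z\<in>V. z \<in> elts (e 0) \<longleftrightarrow>
        (\<exists>i<length vs. z = vpair (vnat i) (g (vs ! i) (\<lambda>i. e (Suc i)))))"
      by (intro dfn_all dfn_iff dfn_mem dfn_finite_disj model dfn_eq dfn_tm_vpair dfn_tm_var dfn_tm_const vnat_in)
        (rule assms[THEN dfn_tm_shift, THEN dfn_tm_shift], simp)
    fix e :: "nat \<Rightarrow> 'a hset" assume e: "range e \<subseteq> V"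
    then have e': "range (\<lambda>i. e (Suc i)) \<subseteq> V" "e 0 \<in> V" by auto
    let ?as = "map (\<lambda>v. g v (\<lambda>i. e (Suc i))) vs"
    have "vtuple ?as \<in> V" using dfn_tm_in[OF assms e'(1)] by (intro vtuple_in) auto
    then have "elts (vtuple ?as) \<subseteq> V" by (rule elts_subset)
    then have "(\<forall>z\<in>V. z \<in> elts (e 0) \<longleftrightarrow> z \<in> elts (vtuple ?as)) \<longleftrightarrow> e 0 = vtuple ?as"
      using eq_vset_iff[OF e'(2), of "elts (vtuple ?as)"] by simp
    then show "e 0 = vtuple ?as \<longleftrightarrow> (\<forall>z\<in>V. z \<in> elts (e 0) \<longleftrightarrow>
        (\<exists>i<length vs. z = vpair (vnat i) (g (vs ! i) (\<lambda>i. e (Suc i)))))"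
      by (auto simp: elts_vtuple)
  qed
qed

text \<open>A finite set receives the structure induced along the injection \<open>h\<close>. Since
  the language may be infinite, closure of \<open>V\<close> under finite sets does not yield
  \<open>B\<close>; its interpretation is obtained from that of \<open>M\<close> by
  replacement.\<close>

lemma ex_pullback:
  assumes M: "M \<in> V" "is_structure L M" and S: "finite S" "S \<subseteq> V" "h ` S \<subseteq> carr M" "inj_on h S"
  shows "\<exists>B\<in>V. is_structure L B \<and> carr B = S \<and> (\<forall>R\<in>vdom L. \<forall>as. length as = arity L R \<and> set as \<subseteq> S \<longrightarrow>
    (vtuple as \<in> interp B R \<longleftrightarrow> vtuple (map h as) \<in> interp M R))"
proof -
  obtain A I where AI: "M = vpair A I" "is_fun I" "vdom I = vdom L"
    and sub: "\<And>R. R \<in> vdom L \<Longrightarrow> interp M R \<subseteq> vtuples (arity L R) (carr M)"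
    using M unfolding is_structure_def maps_def by blast
  have V: "A \<in> V" "I \<in> V" using M vpair_elts_in unfolding AI by blast+
  have carrM: "carr M = elts A" unfolding carr_def AI by simp
  have hV: "h ` S \<subseteq> V" using S(3) elts_subset[OF V(1)] unfolding carrM by blast
  obtain w where w: "w \<in> V" "range vnat \<subseteq> elts w" using ex_omega_bound by blast
  define s where "s = vset S"
  have s: "s \<in> V" "elts s = S" unfolding s_def using S by (simp_all add: finite_in elts_vset_finite)
  define g where "g = fgraph h S"
  have g: "g \<in> V" "\<And>x y. vpair x y \<in> elts g \<longleftrightarrow> x \<in> S \<and> y = h x"
    unfolding g_def using S hV by (auto simp: fgraph_in elts_fgraph)
  obtain b where b: "b \<in> V" "\<forall>x\<in>elts w. \<forall>y\<in>elts s. vpair x y \<in> elts b"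
    using ex_product_bound[OF w(1) s(1)] by blast
  obtain T where T: "T \<in> V" "elts T = {y \<in> V. elts y \<subseteq> elts b}" using Pow_in[OF b(1)] by blast
  define pb where "pb t J \<longleftrightarrow> (\<forall>z\<in>elts t. \<exists>i\<in>elts w. \<exists>x\<in>elts s. z = vpair i x) \<and>
    (\<exists>t'\<in>elts J. \<forall>z\<in>V. z \<in> elts t' \<longleftrightarrow>
      (\<exists>i\<in>V. \<exists>x\<in>V. \<exists>y\<in>V. z = vpair i y \<and> vpair i x \<in> elts t \<and> vpair x y \<in> elts g))" for t J
  have dfn_pb: "dfn V (\<lambda>e. pb (e i) (e j))" for i j
    unfolding pb_def by (intro dfn_intros w s g)
  have pbT: "t \<in> elts T" if "pb t J" "t \<in> V" for t J
  proof -
    have "z \<in> elts b" if "z \<in> elts t" for z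
    proof -
      obtain i x where "i \<in> elts w" "x \<in> elts s" "z = vpair i x"
        using \<open>pb t J\<close> \<open>z \<in> elts t\<close> unfolding pb_def by meson
      then show ?thesis using b(2) by blast
    qed
    then show ?thesis using \<open>t \<in> V\<close> T by blast
  qed
  \<comment> \<open>\<open>Q\<close> sends a symbol paired with its relation \<open>J\<close> to the
    same symbol paired with the pullback of \<open>J\<close>; extensionality makes it
    single-valued.\<close>
  define Q where "Q p q \<longleftrightarrow> (\<exists>R\<in>V. \<exists>J\<in>V. \<exists>J'\<in>V. p = vpair R J \<and> q = vpair R J' \<and> (\<forall>t\<in>V. t \<in> elts J' \<longleftrightarrow> pb t J))" for p q
  have ext: "J = J'" if "J \<in> V" "J' \<in> V" "\<forall>t\<in>V. t \<in> elts J \<longleftrightarrow> t \<in> elts J'" for J J'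
    using that elts_in by (intro hset_ext) blast
  have "\<exists>u\<in>V. elts u = {q \<in> V. \<exists>p\<in>elts I. Q p q}"
  proof (rule replacement_dfn[OF V(2)])
    show "dfn V (\<lambda>e. Q (e 0) (e (Suc 0)))"
      unfolding Q_def by (intro dfn_intros dfn_pb)
  next
    fix p y z assume "Q p y" "Q p z"
    then show "y = z" unfolding Q_def by clarsimp (rule ext; simp)
  qed
  then obtain IB where IB: "IB \<in> V" "elts IB = {q \<in> V. \<exists>p\<in>elts I. Q p q}" by blast
  have fibre: "\<exists>J'\<in>V. \<forall>t. t \<in> elts J' \<longleftrightarrow> t \<in> V \<and> pb t J" if J: "J \<in> V" for J
  proof -
    have "dfn V (\<lambda>e. pb (e 0) J)"
      using dfn_subst2[where R = pb and t = "\<lambda>e. e 0", OF dfn_pb[of 0 1] dfn_tm_var dfn_tm_const[OF J]] .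
    from separation_dfn[OF T(1) this] obtain u where "u \<in> V" "elts u = {x \<in> elts T. pb x J}" by blast
    then show ?thesis using pbT elts_in T(1) by blast
  qed
  have IB_iff: "vpair R J' \<in> elts IB \<longleftrightarrow> J' \<in> V \<and> (\<exists>J. vpair R J \<in> elts I \<and> (\<forall>t\<in>V. t \<in> elts J' \<longleftrightarrow> pb t J))" for R J'
  proof
    assume "vpair R J' \<in> elts IB"
    then show "J' \<in> V \<and> (\<exists>J. vpair R J \<in> elts I \<and> (\<forall>t\<in>V. t \<in> elts J' \<longleftrightarrow> pb t J))"
      unfolding IB(2) Q_def by auto
  next
    assume *: "J' \<in> V \<and> (\<exists>J. vpair R J \<in> elts I \<and> (\<forall>t\<in>V. t \<in> elts J' \<longleftrightarrow> pb t J))"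
    then obtain J where J: "vpair R J \<in> elts I" "\<forall>t\<in>V. t \<in> elts J' \<longleftrightarrow> pb t J" by blast
    have RJ: "R \<in> V" "J \<in> V" using vpair_mem_in[OF J(1) V(2)] by blast+
    have "Q (vpair R J) (vpair R J')" unfolding Q_def
      by (intro bexI[of _ R] bexI[of _ J] bexI[of _ J'] conjI refl J(2) RJ conjunct1[OF *])
    moreover have "vpair R J' \<in> V" using RJ * by (intro vpair_in) auto
    ultimately show "vpair R J' \<in> elts IB" unfolding IB(2) using J(1) by auto
  qed
  have IBpair: "\<exists>R J. z = vpair R J" if "z \<in> elts IB" for z
    using that unfolding IB(2) Q_def by blast
  have fun_IB: "is_fun IB"
    unfolding is_fun_def
  proof (intro conjI ballI allI impI)
    fix a b c assume "vpair a b \<in> elts IB \<and> vpair a c \<in> elts IB"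
    then have bc: "b \<in> V" "c \<in> V"
      and "\<exists>J. vpair a J \<in> elts I \<and> (\<forall>t\<in>V. t \<in> elts b \<longleftrightarrow> pb t J)"
      "\<exists>J. vpair a J \<in> elts I \<and> (\<forall>t\<in>V. t \<in> elts c \<longleftrightarrow> pb t J)"
      unfolding IB_iff by auto
    then have "\<exists>J. (\<forall>t\<in>V. t \<in> elts b \<longleftrightarrow> pb t J) \<and> (\<forall>t\<in>V. t \<in> elts c \<longleftrightarrow> pb t J)"
      using AI(2) unfolding is_fun_def by metis
    then show "b = c" by (intro ext bc) auto
  qed (use IBpair in blast)
  have dom_IB: "vdom IB = vdom L"
  proof (intro equalityI subsetI)
    fix R assume "R \<in> vdom IB"
    then have "R \<in> vdom I" unfolding vdom_def IB_iff by blast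
    then show "R \<in> vdom L" unfolding AI(3) .
  next
    fix R assume "R \<in> vdom L"
    then have "R \<in> vdom I" unfolding AI(3) .
    then obtain J where J: "vpair R J \<in> elts I" unfolding vdom_def by blast
    then have "J \<in> V" using vpair_mem_in V by blast
    then obtain J' where "J' \<in> V" "\<forall>t. t \<in> elts J' \<longleftrightarrow> t \<in> V \<and> pb t J" using fibre by blast
    then show "R \<in> vdom IB" unfolding vdom_def IB_iff using J by blast
  qed
  define B where "B = vpair s IB"
  have interpM: "vpair R (vapp I R) \<in> elts I" if "R \<in> vdom L" for R
    using that AI vpair_vapp by metis
  have interpB: "t \<in> interp B R \<longleftrightarrow> t \<in> V \<and> pb t (vapp I R)" if R: "R \<in> vdom L" for R t
  proof -
    have 1: "vpair R (vapp IB R) \<in> elts IB" using R fun_IB dom_IB vpair_vapp by metis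
    then obtain J where J: "vpair R J \<in> elts I" "vapp IB R \<in> V" "\<forall>t\<in>V. t \<in> elts (vapp IB R) \<longleftrightarrow> pb t J"
      unfolding IB_iff by blast
    then have "J = vapp I R" using vapp_eqI AI by metis
    moreover have "t \<in> V" if "t \<in> elts (vapp IB R)" using that J(2) elts_in by blast
    ultimately show ?thesis unfolding interp_def B_def using J by auto
  qed
  have is_interpM: "interp M R = elts (vapp I R)" for R unfolding interp_def AI by simp
  have strB: "interp B R \<subseteq> vtuples (arity L R) S" if R: "R \<in> vdom L" for R
  proof
    fix t assume "t \<in> interp B R"
    then have t: "t \<in> V" "pb t (vapp I R)" using interpB R by auto
    then obtain t' where t': "t' \<in> interp M R" and iff: "\<forall>z\<in>V. z \<in> elts t' \<longleftrightarrow>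
      (\<exists>i\<in>V. \<exists>x\<in>V. \<exists>y\<in>V. z = vpair i y \<and> vpair i x \<in> elts t \<and> vpair x y \<in> elts g)"
      and tw: "\<forall>z\<in>elts t. \<exists>i\<in>elts w. \<exists>x\<in>S. z = vpair i x"
      unfolding pb_def is_interpM s by blast
    have t'2: "is_fun t'" "vdom t' = elts (vnat (arity L R))"
      using sub[OF R] t' unfolding vtuples_def maps_def by blast+
    have "t' \<in> V"
    proof -
      have "vapp I R \<in> V" using interpM[OF R] vpair_mem_in V by blast
      then show ?thesis using t' elts_in unfolding is_interpM by blast
    qed
    have 1: "vpair i (h x) \<in> elts t'" "i \<in> V" "x \<in> S" if ix: "vpair i x \<in> elts t" for i x
    proof -
      show "i \<in> V" using ix vpair_mem_in t by blast
      show "x \<in> S" using ix tw by fastforce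
      then have "x \<in> V" "h x \<in> V" "vpair x (h x) \<in> elts g" using S hV g by auto
      then show "vpair i (h x) \<in> elts t'" using iff \<open>i \<in> V\<close> ix vpair_in by blast
    qed
    \<comment> \<open>The composition with \<open>h\<close> is a function, and injectivity of
      \<open>h\<close> on \<open>S\<close> carries this over to \<open>t\<close>.\<close>
    have "is_fun t"
      unfolding is_fun_def
    proof (intro conjI ballI allI impI)
      fix z assume "z \<in> elts t" then show "\<exists>a b. z = vpair a b" using tw by blast
    next
      fix a b c assume "vpair a b \<in> elts t \<and> vpair a c \<in> elts t"
      then have "vpair a (h b) \<in> elts t'" "vpair a (h c) \<in> elts t'" "b \<in> S" "c \<in> S" using 1 by blast+
      then have "h b = h c" using t'2 unfolding is_fun_def by blast
      then show "b = c" using \<open>b \<in> S\<close> \<open>c \<in> S\<close> S(4) by (simp add: inj_on_def)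
    qed
    moreover have "vdom t = vdom t'"
    proof (intro equalityI subsetI)
      fix i assume "i \<in> vdom t" then show "i \<in> vdom t'" using 1 unfolding vdom_def by blast
    next
      fix i assume "i \<in> vdom t'"
      then obtain y where y: "vpair i y \<in> elts t'" unfolding vdom_def by blast
      then have "vpair i y \<in> V" using \<open>t' \<in> V\<close> elts_in by blast
      then show "i \<in> vdom t" using iff y unfolding vdom_def by auto
    qed
    ultimately show "t \<in> vtuples (arity L R) S"
      unfolding vtuples_def maps_def using t'2 by (auto intro: 1(3) vpair_vapp)
  qed
  have carrB: "carr B = S" unfolding carr_def B_def by (simp add: s)
  have "is_structure L B"
    unfolding is_structure_def carrB using strB fun_IB dom_IB unfolding maps_def B_def by auto
  moreover have "vtuple as \<in> interp B R \<longleftrightarrow> vtuple (map h as) \<in> interp M R"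
    if R: "R \<in> vdom L" and as: "length as = arity L R" "set as \<subseteq> S" for R as
  proof -
    have "set as \<subseteq> V" "set (map h as) \<subseteq> V" using as S(2) hV by auto
    then have asV: "vtuple as \<in> V" "vtuple (map h as) \<in> V" by (simp_all add: vtuple_in)
    have comp: "(\<exists>i\<in>V. \<exists>x\<in>V. \<exists>y\<in>V. z = vpair i y \<and> vpair i x \<in> elts (vtuple as) \<and> vpair x y \<in> elts g)
        \<longleftrightarrow> z \<in> elts (vtuple (map h as))" for z
    proof
      assume "z \<in> elts (vtuple (map h as))"
      then obtain i where i: "i < length as" "z = vpair (vnat i) (h (as ! i))"
        by (auto simp: elts_vtuple)
      have "as ! i \<in> S" using i as by auto
      then show "\<exists>i\<in>V. \<exists>x\<in>V. \<exists>y\<in>V. z = vpair i y \<and> vpair i x \<in> elts (vtuple as) \<and> vpair x y \<in> elts g"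
        using i S hV
        by (intro bexI[of _ "vnat i"] bexI[of _ "as ! i"] bexI[of _ "h (as ! i)"])
          (auto simp: g elts_vtuple vnat_in)
    qed (auto simp: elts_vtuple g)
    have pairs: "\<forall>z\<in>elts (vtuple as). \<exists>i\<in>elts w. \<exists>x\<in>elts s. z = vpair i x"
      using as w unfolding s by (fastforce simp: elts_vtuple)
    have "vtuple as \<in> interp B R \<longleftrightarrow> pb (vtuple as) (vapp I R)"
      using interpB[OF R] asV by blast
    also have "\<dots> \<longleftrightarrow> (\<exists>t'\<in>elts (vapp I R). \<forall>z\<in>V. z \<in> elts t' \<longleftrightarrow> z \<in> elts (vtuple (map h as)))"
      unfolding pb_def comp using pairs by blast
    also have "\<dots> \<longleftrightarrow> vtuple (map h as) \<in> elts (vapp I R)"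
    proof -
      have "vapp I R \<in> V" using interpM[OF R] vpair_mem_in V by blast
      then show ?thesis using ext asV elts_in by blast
    qed
    finally show ?thesis unfolding is_interpM .
  qed
  moreover have "B \<in> V" unfolding B_def using s IB vpair_in by blast
  ultimately show ?thesis using carrB by blast
qed

end


section \<open>Canonical names\<close>

text \<open>One condition \<open>u\<close> is attached throughout, and any \<open>u\<close> in the
  filter gives the right value. Later \<open>u\<close> is the empty structure, the weakest
  condition, which lies in every filter.\<close>

function check_name :: "'a hset \<Rightarrow> 'a hset \<Rightarrow> 'a hset" where
  "check_name u x = vset ((\<lambda>y. vpair (check_name u y) u) ` elts x)"
  by auto
termination
  by (relation "inv_image {(x, y). x \<in> elts y} snd") (auto simp: wf_elts)

declare check_name.simps [simp del]

lemma elts_check_name: "elts (check_name u x) = (\<lambda>y. vpair (check_name u y) u) ` elts x"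
  by (subst check_name.simps) (rule elts_vset_image[OF subset_refl])

lemma is_name_check_name: "u \<in> P \<Longrightarrow> is_name P (check_name u x)"
proof (induction x rule: hset_induct)
  case (step x)
  show ?case
    by (rule is_name.intros) (use step in \<open>auto simp: elts_check_name\<close>)
qed

lemma val_check_name: "u \<in> elts G \<Longrightarrow> val G (check_name u x) = x"
proof (induction x rule: hset_induct)
  case (step x)
  have "elts (val G (check_name u x)) = (\<lambda>y. val G (check_name u y)) ` elts x"
    unfolding elts_val elts_check_name using step.prems by auto
  also have "\<dots> = elts x" using step by simp
  finally show ?case by (rule hset_ext)
qed

context transitive_model
begin

text \<open>\<open>f\<close> approximates the function \<open>check_name u\<close> on a transitive domain.\<close>
definition check_approx :: "'a hset \<Rightarrow> 'a hset \<Rightarrow> bool" where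
  "check_approx u f \<longleftrightarrow> (\<forall>y\<in>V. \<forall>v\<in>V. vpair y v \<in> elts f \<longrightarrow>
    (\<forall>z\<in>elts y. \<exists>w\<in>V. vpair z w \<in> elts f \<and> vpair w u \<in> elts v) \<and>
    (\<forall>p\<in>elts v. \<exists>z\<in>elts y. \<exists>w\<in>V. vpair z w \<in> elts f \<and> p = vpair w u))"

lemma dfn_check_approx: "u \<in> V \<Longrightarrow> dfn V (\<lambda>e. check_approx u (e i))"
  unfolding check_approx_def by (intro dfn_intros)

text \<open>The domain of an approximation is closed under elements, so \<in>-induction determines
  its values.\<close>

lemma check_approx_unique:
  assumes "f \<in> V" "check_approx u f"
  shows "vpair y v \<in> elts f \<Longrightarrow> v = check_name u y"
proof (induction y arbitrary: v rule: hset_induct)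
  case (step y)
  have V: "y \<in> V" "v \<in> V" using step.prems assms(1) vpair_mem_in by blast+
  have 1: "\<forall>z\<in>elts y. \<exists>w\<in>V. vpair z w \<in> elts f \<and> vpair w u \<in> elts v"
    "\<forall>p\<in>elts v. \<exists>z\<in>elts y. \<exists>w\<in>V. vpair z w \<in> elts f \<and> p = vpair w u"
    using assms(2) V step.prems unfolding check_approx_def by blast+
  show ?case
  proof (rule hset_ext, unfold elts_check_name, intro equalityI subsetI)
    fix p assume "p \<in> elts v"
    then obtain z w where "z \<in> elts y" "vpair z w \<in> elts f" "p = vpair w u" using 1(2) by blast
    then show "p \<in> (\<lambda>y. vpair (check_name u y) u) ` elts y" using step.IH by blast
  next
    fix p assume "p \<in> (\<lambda>y. vpair (check_name u y) u) ` elts y"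
    then obtain z where z: "z \<in> elts y" "p = vpair (check_name u z) u" by blast
    then obtain w where "vpair z w \<in> elts f" "vpair w u \<in> elts v" using 1(1) by blast
    then show "p \<in> elts v" using step.IH z by blast
  qed
qed

text \<open>This is \<open>check_name u\<close> restricted to the transitive closure of
  \<open>{x}\<close>, characterized by minimality so that no transitive closure has to be defined in
  \<open>V\<close>.\<close>

definition least_approx :: "'a hset \<Rightarrow> 'a hset \<Rightarrow> 'a hset \<Rightarrow> bool" where
  "least_approx u x f \<longleftrightarrow> check_approx u f \<and> (\<exists>v\<in>V. vpair x v \<in> elts f) \<and>
    (\<forall>g\<in>V. check_approx u g \<and> (\<exists>v\<in>V. vpair x v \<in> elts g) \<longrightarrow> (\<forall>p\<in>elts f. p \<in> elts g))"

lemma dfn_least_approx: "u \<in> V \<Longrightarrow> dfn V (\<lambda>e. least_approx u (e i) (e j))"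
  unfolding least_approx_def by (intro dfn_intros dfn_check_approx)

lemma least_approx_unique:
  "f \<in> V \<Longrightarrow> g \<in> V \<Longrightarrow> least_approx u x f \<Longrightarrow> least_approx u x g \<Longrightarrow> f = g"
  unfolding least_approx_def by (intro hset_ext) blast

lemma least_approx_val:
  assumes "least_approx u x f" "f \<in> V"
  shows "vpair x (check_name u x) \<in> elts f"
  using assms check_approx_unique unfolding least_approx_def by blast

text \<open>Least approximations are unique, so that replacement applies to the family of the least
  approximations of the elements of a set.\<close>
lemma ex_least_approx:
  assumes u: "u \<in> V"
  shows "x \<in> V \<Longrightarrow> check_name u x \<in> V \<and> (\<exists>f\<in>V. least_approx u x f)"
proof (induction x rule: hset_induct)
  case (step x)
  have IH: "\<exists>f\<in>V. least_approx u y f" "check_name u y \<in> V" "y \<in> V" if "y \<in> elts x" for y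
    using step that elts_in by blast+
  have "\<exists>F\<in>V. elts F = {f \<in> V. \<exists>y\<in>elts x. least_approx u y f}"
    by (rule replacement_dfn[OF step.prems dfn_least_approx[OF u, of 0 "Suc 0"]]) (rule least_approx_unique)
  then obtain F where F: "F \<in> V" "elts F = {f \<in> V. \<exists>y\<in>elts x. least_approx u y f}" by blast
  let ?R = "\<lambda>y q. \<exists>f\<in>V. \<exists>v\<in>V. least_approx u y f \<and> vpair y v \<in> elts f \<and> q = vpair v u"
  have val: "v = check_name u y" if "f \<in> V" "least_approx u y f" "vpair y v \<in> elts f" for y f v
    using that check_approx_unique unfolding least_approx_def by blast
  have "\<exists>W\<in>V. elts W = {q \<in> V. \<exists>y\<in>elts x. ?R y q}"
  proof (rule replacement_dfn[OF step.prems])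
    show "dfn V (\<lambda>e. ?R (e 0) (e (Suc 0)))"
      by (intro dfn_intros dfn_least_approx u)
    fix y q r assume "?R y q" "?R y r"
    then show "q = r" using val by blast
  qed
  then obtain W where W: "W \<in> V" "elts W = {q \<in> V. \<exists>y\<in>elts x. ?R y q}" by blast
  have "W = check_name u x"
  proof (rule hset_ext, unfold elts_check_name, intro equalityI subsetI)
    fix q assume "q \<in> elts W"
    then show "q \<in> (\<lambda>y. vpair (check_name u y) u) ` elts x" unfolding W(2) using val by blast
  next
    fix q assume "q \<in> (\<lambda>y. vpair (check_name u y) u) ` elts x"
    then obtain y where y: "y \<in> elts x" "q = vpair (check_name u y) u" by blast
    obtain f where f: "f \<in> V" "least_approx u y f" using IH y by blast
    have "?R y q" using f least_approx_val[OF f(2,1)] IH(2)[OF y(1)] y(2) by blast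
    then show "q \<in> elts W" unfolding W(2) using y vpair_in IH u by blast
  qed
  then have xV: "check_name u x \<in> V" using W by simp
  \<comment> \<open>The least approximation for \<open>x\<close> is the union of those for its
    elements, with the pair for \<open>x\<close> itself added.\<close>
  obtain U where U: "U \<in> V" "elts U = (\<Union>f\<in>elts F. elts f)" using Union_in[OF F(1)] by blast
  obtain f' where f': "f' \<in> V" "elts f' = insert (vpair x (check_name u x)) (elts U)"
    using insert_in[OF vpair_in[OF step.prems xV] U(1)] by blast
  have sub: "elts f \<subseteq> elts f'" if "f \<in> elts F" for f using that U f' by blast
  have "check_approx u f'"
    unfolding check_approx_def
  proof (intro ballI impI)
    fix y v assume y: "y \<in> V" "v \<in> V" "vpair y v \<in> elts f'"
    show "(\<forall>z\<in>elts y. \<exists>w\<in>V. vpair z w \<in> elts f' \<and> vpair w u \<in> elts v) \<and>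
      (\<forall>p\<in>elts v. \<exists>z\<in>elts y. \<exists>w\<in>V. vpair z w \<in> elts f' \<and> p = vpair w u)"
    proof (cases "vpair y v \<in> elts U")
      case True
      then obtain f where f: "f \<in> elts F" "vpair y v \<in> elts f" using U by blast
      then have "check_approx u f" unfolding F(2) least_approx_def by blast
      then have "(\<forall>z\<in>elts y. \<exists>w\<in>V. vpair z w \<in> elts f \<and> vpair w u \<in> elts v) \<and>
        (\<forall>p\<in>elts v. \<exists>z\<in>elts y. \<exists>w\<in>V. vpair z w \<in> elts f \<and> p = vpair w u)"
        using f(2) y(1,2) unfolding check_approx_def by blast
      then show ?thesis using sub[OF f(1)] by (meson subsetD)
    next
      case False
      then have yv: "y = x" "v = check_name u x" using y(3) f' by auto
      have *: "vpair z (check_name u z) \<in> elts f'" if z: "z \<in> elts x" for z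
      proof -
        obtain f where f: "f \<in> V" "least_approx u z f" using IH z by blast
        then have "f \<in> elts F" unfolding F(2) using z by blast
        then show ?thesis using sub least_approx_val[OF f(2,1)] by blast
      qed
      show ?thesis unfolding yv
      proof (intro conjI ballI)
        fix z assume z: "z \<in> elts x"
        then show "\<exists>w\<in>V. vpair z w \<in> elts f' \<and> vpair w u \<in> elts (check_name u x)"
          using * IH(2) by (intro bexI[of _ "check_name u z"]) (auto simp: elts_check_name)
      next
        fix p assume "p \<in> elts (check_name u x)"
        then obtain z where z: "z \<in> elts x" "p = vpair (check_name u z) u"
          by (auto simp: elts_check_name)
        then show "\<exists>z\<in>elts x. \<exists>w\<in>V. vpair z w \<in> elts f' \<and> p = vpair w u"
          using * IH(2) by blast
      qed
    qed
  qed
  moreover have "elts f' \<subseteq> elts g" if g: "g \<in> V" "check_approx u g" "v \<in> V" "vpair x v \<in> elts g" for g v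
  proof -
    have x: "vpair x (check_name u x) \<in> elts g" using g check_approx_unique by blast
    \<comment> \<open>An approximation defined at \<open>x\<close> is defined at the elements of
      \<open>x\<close>, hence contains their least approximations.\<close>
    moreover have "elts f \<subseteq> elts g" if "f \<in> elts F" for f
    proof -
      obtain y where y: "y \<in> elts x" "least_approx u y f" using \<open>f \<in> elts F\<close> unfolding F(2) by blast
      then have "\<exists>w\<in>V. vpair y w \<in> elts g"
        using g step.prems unfolding check_approx_def by blast
      then show ?thesis using y(2) g(1,2) unfolding least_approx_def by blast
    qed
    ultimately show ?thesis unfolding f'(2) U(2) by (simp add: UN_subset_iff)
  qed
  moreover have "vpair x (check_name u x) \<in> elts f'" using f' by blast
  ultimately have "least_approx u x f'" unfolding least_approx_def using xV by blast
  then show ?case using xV f' by blast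
qed

lemma check_name_in: "u \<in> V \<Longrightarrow> x \<in> V \<Longrightarrow> check_name u x \<in> V"
  using ex_least_approx by blast

lemma dfn_check_name:
  assumes u: "u \<in> V"
  shows "dfn V (\<lambda>e. e i = check_name u (e j))"
proof (rule dfn_cong)
  show "dfn V (\<lambda>e. \<exists>f\<in>V. least_approx u (e j) f \<and> vpair (e j) (e i) \<in> elts f)"
    by (intro dfn_intros dfn_least_approx u)
  fix e :: "nat \<Rightarrow> 'a hset" assume "range e \<subseteq> V"
  then have "e j \<in> V" by auto
  then obtain f where f: "f \<in> V" "least_approx u (e j) f" using ex_least_approx[OF u] by blast
  show "e i = check_name u (e j) \<longleftrightarrow> (\<exists>f\<in>V. least_approx u (e j) f \<and> vpair (e j) (e i) \<in> elts f)"
    using f least_approx_val[OF f(2,1)] check_approx_unique unfolding least_approx_def by metis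
qed

lemma dfn_tm_check_name: "u \<in> V \<Longrightarrow> dfn_tm V (\<lambda>e. check_name u (e i))"
  unfolding dfn_tm_def using dfn_check_name[of u 0 "Suc i"] by (auto intro!: check_name_in)


section \<open>The set of conditions\<close>

lemma dfn_class:
  assumes "class_of V K" shows "dfn V (\<lambda>e. e i \<in> K)"
proof -
  obtain \<phi> c where c: "range c \<subseteq> V" and K: "K = {x \<in> V. sats V (case_nat x c) \<phi>}"
    using assms unfolding class_of_def by blast
  let ?r = "case_nat (2 * i) (\<lambda>k. Suc (2 * k))"
  have "(\<lambda>k. merge e c (?r k)) = case_nat (e i) c" for e
    by (auto simp: fun_eq_iff split: nat.split)
  then have "e i \<in> K \<longleftrightarrow> sats V (merge e c) (rename_fm ?r \<phi>)" if "range e \<subseteq> V" for e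
    using that unfolding K sats_rename_fm by auto
  with c show ?thesis unfolding dfn_def by blast
qed

lemma class_subset: "class_of V K \<Longrightarrow> K \<subseteq> V"
  unfolding class_of_def by blast

lemma dfn_carr_subset:
  assumes "X \<in> V" shows "dfn V (\<lambda>e. \<exists>A\<in>V. \<exists>I\<in>V. e i = vpair A I \<and> (\<forall>x\<in>elts A. x \<in> elts X))"
  by (intro dfn_intros assms)

text \<open>Although \<open>K\<close> is a proper class, a structure with carrier inside
  \<open>X\<close> lies in a set obtained from \<open>X\<close>, the symbols and the indices by
  products and power sets. Separation with the formula for \<open>K\<close> cuts out the
  conditions.\<close>

lemma ex_C_conditions:
  assumes X: "X \<in> V" and L: "L \<in> V" and K: "class_of V K" and str: "\<forall>M\<in>K. is_structure L M"
  shows "\<exists>c\<in>V. elts c = C_conditions X K"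
proof -
  obtain w where w: "w \<in> V" "range vnat \<subseteq> elts w" using ex_omega_bound by blast
  obtain D where D: "D \<in> V" "elts D = {R \<in> V. \<exists>z\<in>elts L. \<exists>n\<in>V. z = vpair R n}"
  proof -
    have "\<exists>D\<in>V. elts D = {R \<in> V. \<exists>z\<in>elts L. \<exists>n\<in>V. z = vpair R n}"
      by (rule replacement_dfn[OF L]) (intro dfn_intros, auto)
    then show thesis using that by blast
  qed
  \<comment> \<open>\<open>b1\<close> to \<open>b7\<close> bound, in this order, the index-point
    pairs, the tuples, the relations, the symbol-relation pairs, the interpretations, the carriers
    and the structures.\<close>
  obtain b1 where b1: "b1 \<in> V" "\<forall>x\<in>elts w. \<forall>y\<in>elts X. vpair x y \<in> elts b1"
    using ex_product_bound[OF w(1) X] by blast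
  obtain b2 where b2: "b2 \<in> V" "elts b2 = {y \<in> V. elts y \<subseteq> elts b1}" using Pow_in[OF b1(1)] by blast
  obtain b3 where b3: "b3 \<in> V" "elts b3 = {y \<in> V. elts y \<subseteq> elts b2}" using Pow_in[OF b2(1)] by blast
  obtain b4 where b4: "b4 \<in> V" "\<forall>x\<in>elts D. \<forall>y\<in>elts b3. vpair x y \<in> elts b4"
    using ex_product_bound[OF D(1) b3(1)] by blast
  obtain b5 where b5: "b5 \<in> V" "elts b5 = {y \<in> V. elts y \<subseteq> elts b4}" using Pow_in[OF b4(1)] by blast
  obtain b6 where b6: "b6 \<in> V" "elts b6 = {y \<in> V. elts y \<subseteq> elts X}" using Pow_in[OF X] by blast
  obtain b7 where b7: "b7 \<in> V" "\<forall>x\<in>elts b6. \<forall>y\<in>elts b5. vpair x y \<in> elts b7"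
    using ex_product_bound[OF b6(1) b5(1)] by blast
  have bound: "M \<in> elts b7" if M: "M \<in> K" "carr M \<subseteq> elts X" for M
  proof -
    have "M \<in> V" using M class_subset K by blast
    have "is_structure L M" using str M by blast
    then obtain A I where AI: "M = vpair A I" "is_fun I" "vdom I = vdom L"
      and sub: "\<And>R. R \<in> vdom L \<Longrightarrow> interp M R \<subseteq> vtuples (arity L R) (carr M)"
      unfolding is_structure_def maps_def by blast
    have V: "A \<in> V" "I \<in> V" using \<open>M \<in> V\<close> vpair_elts_in unfolding AI by blast+
    have "A \<in> elts b6" using M V unfolding b6 AI carr_def by simp
    moreover have "I \<in> elts b5"
      unfolding b5
    proof (intro CollectI conjI V subsetI)
      fix z assume "z \<in> elts I"
      then obtain R J where z: "z = vpair R J" "vpair R J \<in> elts I" using AI(2) unfolding is_fun_def by metis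
      then have RJ: "R \<in> V" "J \<in> V" using vpair_mem_in V by blast+
      have "R \<in> vdom I" using z unfolding vdom_def by blast
      then have R: "R \<in> vdom L" unfolding AI(3) .
      then obtain n where n: "vpair R n \<in> elts L" unfolding vdom_def by blast
      then have "n \<in> V" using vpair_mem_in L by blast
      then have "R \<in> elts D" unfolding D using RJ n by blast
      moreover have "J \<in> elts b3"
        unfolding b3
      proof (intro CollectI conjI RJ subsetI)
        fix t assume t: "t \<in> elts J"
        have "interp M R = elts J" unfolding interp_def AI using vapp_eqI[OF AI(2) z(2)] by simp
        then obtain as where as: "t = vtuple as" "set as \<subseteq> elts X"
          using sub[OF R] t M(2) unfolding vtuples_eq by blast
        have "elts t \<subseteq> elts b1"
          using as b1(2) w(2) by (auto simp: elts_vtuple subset_iff)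
        then show "t \<in> elts b2" unfolding b2 using t RJ elts_in by blast
      qed
      ultimately show "z \<in> elts b4" using b4 z by blast
    qed
    ultimately show ?thesis using b7 AI by blast
  qed
  have "dfn V (\<lambda>e. e 0 \<in> K \<and> (\<exists>A\<in>V. \<exists>I\<in>V. e 0 = vpair A I \<and> (\<forall>x\<in>elts A. x \<in> elts X)))"
    by (intro dfn_conj dfn_class K dfn_carr_subset X)
  from separation_dfn[OF b7(1) this] obtain c where c: "c \<in> V"
    "elts c = {M \<in> elts b7. M \<in> K \<and> (\<exists>A\<in>V. \<exists>I\<in>V. M = vpair A I \<and> (\<forall>x\<in>elts A. x \<in> elts X))}" by blast
  have "(\<exists>A\<in>V. \<exists>I\<in>V. M = vpair A I \<and> (\<forall>x\<in>elts A. x \<in> elts X)) \<longleftrightarrow> carr M \<subseteq> elts X" if M: "M \<in> K" for M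
  proof -
    have "M \<in> V" using M class_subset K by blast
    obtain A I where AI: "M = vpair A I" using str M unfolding is_structure_def by blast
    then have "A \<in> V" "I \<in> V" using \<open>M \<in> V\<close> vpair_elts_in by blast+
    then show ?thesis unfolding AI carr_def by auto
  qed
  then have "elts c = C_conditions X K" unfolding c C_conditions_def using bound by blast
  then show ?thesis using c by blast
qed

end


section \<open>Structures and embeddings\<close>

text \<open>Partial embeddings: \<open>S\<close> may be smaller than the carrier, like the base of
  an amalgamation, and \<open>h\<close> is a function of the logic instead of an element of
  \<open>V\<close>.\<close>

definition preserves :: "'a hset \<Rightarrow> ('a hset \<Rightarrow> 'a hset) \<Rightarrow> 'a hset \<Rightarrow> 'a hset \<Rightarrow> 'a hset set \<Rightarrow> bool" where
  "preserves L h M N S \<longleftrightarrow> (\<forall>R\<in>vdom L. \<forall>as. length as = arity L R \<and> set as \<subseteq> S \<longrightarrow>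
    (vtuple as \<in> interp M R \<longleftrightarrow> vtuple (map h as) \<in> interp N R))"

lemma preservesD:
  "preserves L h M N S \<Longrightarrow> R \<in> vdom L \<Longrightarrow> length as = arity L R \<Longrightarrow> set as \<subseteq> S \<Longrightarrow>
    vtuple as \<in> interp M R \<longleftrightarrow> vtuple (map h as) \<in> interp N R"
  unfolding preserves_def by blast

lemma embedding_iff:
  "embedding L f M N \<longleftrightarrow> maps f (carr M) (carr N) \<and> inj_on (vapp f) (carr M) \<and>
    preserves L (vapp f) M N (carr M)"
  unfolding embedding_def preserves_def by blast

lemma preserves_cong: "(\<And>x. x \<in> S \<Longrightarrow> h x = k x) \<Longrightarrow> preserves L h M N S \<longleftrightarrow> preserves L k M N S"
  unfolding preserves_def by (intro ball_cong all_cong refl) (metis map_cong subsetD)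

lemma embedding_fgraph:
  assumes "finite (carr M)"
  shows "embedding L (fgraph h (carr M)) M N \<longleftrightarrow>
    h ` carr M \<subseteq> carr N \<and> inj_on h (carr M) \<and> preserves L h M N (carr M)"
proof -
  have "inj_on (vapp (fgraph h (carr M))) (carr M) \<longleftrightarrow> inj_on h (carr M)"
    by (rule inj_on_cong) (simp add: vapp_fgraph assms)
  moreover have "preserves L (vapp (fgraph h (carr M))) M N (carr M) \<longleftrightarrow> preserves L h M N (carr M)"
    by (rule preserves_cong) (simp add: vapp_fgraph assms)
  ultimately show ?thesis by (simp add: embedding_iff maps_fgraph assms)
qed

lemma substructure_iff:
  "substructure L N M \<longleftrightarrow> is_structure L N \<and> is_structure L M \<and> carr N \<subseteq> carr M \<and>
    preserves L id N M (carr N)"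
proof (cases "is_structure L N")
  case True
  have "interp N R = interp M R \<inter> vtuples (arity L R) (carr N) \<longleftrightarrow>
    (\<forall>as. length as = arity L R \<and> set as \<subseteq> carr N \<longrightarrow> (vtuple as \<in> interp N R \<longleftrightarrow> vtuple as \<in> interp M R))"
    if R: "R \<in> vdom L" for R
  proof -
    have sub: "interp N R \<subseteq> vtuples (arity L R) (carr N)" using True R unfolding is_structure_def by blast
    show ?thesis
    proof
      assume eq: "interp N R = interp M R \<inter> vtuples (arity L R) (carr N)"
      show "\<forall>as. length as = arity L R \<and> set as \<subseteq> carr N \<longrightarrow> (vtuple as \<in> interp N R \<longleftrightarrow> vtuple as \<in> interp M R)"
        unfolding eq vtuples_eq by auto
    next
      assume *: "\<forall>as. length as = arity L R \<and> set as \<subseteq> carr N \<longrightarrow> (vtuple as \<in> interp N R \<longleftrightarrow> vtuple as \<in> interp M R)"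
      show "interp N R = interp M R \<inter> vtuples (arity L R) (carr N)"
        using sub * unfolding vtuples_eq by (auto simp: image_iff subset_iff)
    qed
  qed
  then show ?thesis unfolding substructure_def preserves_def by auto
qed (simp add: substructure_def)

lemma substructure_refl: "is_structure L M \<Longrightarrow> substructure L M M"
  by (simp add: substructure_iff preserves_def)

lemma substructure_trans:
  assumes "substructure L A B" "substructure L B C" shows "substructure L A C"
proof -
  have "preserves L id A C (carr A)"
    unfolding preserves_def
  proof (intro ballI allI impI)
    fix R as assume "R \<in> vdom L" "length as = arity L R \<and> set as \<subseteq> carr A"
    then show "vtuple as \<in> interp A R \<longleftrightarrow> vtuple (map id as) \<in> interp C R"
      using assms unfolding substructure_iff preserves_def by auto
  qed
  then show ?thesis using assms unfolding substructure_iff by blast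
qed

lemma (in transitive_model) carr_subset:
  assumes "M \<in> V" "is_structure L M" shows "carr M \<subseteq> V"
proof -
  obtain A I where M: "M = vpair A I" using assms(2) unfolding is_structure_def by blast
  then have "A \<in> V" using assms(1) vpair_elts_in by blast
  then show ?thesis unfolding M carr_def by (simp add: elts_subset)
qed

section \<open>Pullbacks and one-point extensions in \<open>K\<close>\<close>

locale strong_Fraisse = transitive_model V for V :: "'a hset set" +
  fixes L :: "'a hset" and K :: "'a hset set"
  assumes L: "L \<in> V" and Fraisse: "strong_Fraisse_class V L K"
begin

lemma K_class: "class_of V K"
  using Fraisse unfolding strong_Fraisse_class_def collection_of_finite_structures_def by blast

lemma K_member:
  assumes "M \<in> K" shows "M \<in> V" "is_structure L M" "finite (carr M)" "carr M \<subseteq> V"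
proof -
  show *: "M \<in> V" "is_structure L M" "finite (carr M)"
    using assms Fraisse class_subset[OF K_class]
    unfolding strong_Fraisse_class_def collection_of_finite_structures_def by blast+
  then show "carr M \<subseteq> V" using carr_subset by blast
qed

lemma K_isomorphic: "M \<in> K \<Longrightarrow> N \<in> V \<Longrightarrow> is_structure L N \<Longrightarrow> f \<in> V \<Longrightarrow> isomorphism L f M N \<Longrightarrow> N \<in> K"
  using Fraisse unfolding strong_Fraisse_class_def collection_of_finite_structures_def by blast

lemma K_substructure: "M \<in> K \<Longrightarrow> N \<in> V \<Longrightarrow> substructure L N M \<Longrightarrow> N \<in> K"
  using Fraisse unfolding strong_Fraisse_class_def HP_def by blast

text \<open>HP speaks of actual substructures. The image of \<open>h\<close> carries a substructure
  of \<open>M\<close>, which is in \<open>K\<close> by HP, and \<open>B\<close> is isomorphic to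
  it.\<close>

lemma K_embedded:
  assumes B: "B \<in> V" "is_structure L B" and M: "M \<in> K"
    and h: "h ` carr B \<subseteq> carr M" "inj_on h (carr B)" "preserves L h B M (carr B)"
  shows "B \<in> K"
proof -
  note M' = K_member[OF M]
  have fin: "finite (h ` carr B)" "h ` carr B \<subseteq> V" using h M' finite_subset by blast+
  \<comment> \<open>Pulling back along the identity gives the substructure of \<open>M\<close> on
    the image of \<open>h\<close> as an element of \<open>V\<close>.\<close>
  obtain N where N: "N \<in> V" "is_structure L N" "carr N = h ` carr B"
    and N_iff: "\<And>R as. R \<in> vdom L \<Longrightarrow> length as = arity L R \<Longrightarrow> set as \<subseteq> h ` carr B \<Longrightarrow>
      vtuple as \<in> interp N R \<longleftrightarrow> vtuple (map id as) \<in> interp M R"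
    using ex_pullback[OF M'(1,2) fin, of id] h(1) by auto
  have "substructure L N M"
    unfolding substructure_iff preserves_def using N N_iff M' h(1) by simp
  then have NK: "N \<in> K" using K_substructure M N by blast
  \<comment> \<open>Closure under isomorphism is applied to a map from the known member
    \<open>N\<close> to \<open>B\<close>, hence to the inverse of \<open>h\<close>.\<close>
  define k where "k = inv_into (carr B) h"
  have kN: "k ` carr N = carr B" unfolding N(3) k_def using h(2) by (simp add: inv_into_image_cancel)
  have hk: "h (k y) = y" if "y \<in> carr N" for y
    using that unfolding N(3) k_def by (simp add: f_inv_into_f)
  have "preserves L k N B (carr N)"
    unfolding preserves_def
  proof (intro ballI allI impI)
    fix R as assume R: "R \<in> vdom L" and as: "length as = arity L R \<and> set as \<subseteq> carr N"
    have "map h (map k as) = as" using as hk by (simp add: map_idI subset_iff)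
    moreover have "set (map k as) \<subseteq> carr B" using as kN by auto
    ultimately have "vtuple (map k as) \<in> interp B R \<longleftrightarrow> vtuple as \<in> interp M R"
      using preservesD[OF h(3) R, of "map k as"] as by simp
    then show "vtuple as \<in> interp N R \<longleftrightarrow> vtuple (map k as) \<in> interp B R"
      using N_iff[OF R] as N(3) by simp
  qed
  moreover have "inj_on k (carr N)" using hk by (metis inj_onI)
  moreover have finN: "finite (carr N)" using N fin by simp
  ultimately have "embedding L (fgraph k (carr N)) N B"
    using kN by (simp add: embedding_fgraph)
  moreover have "vapp (fgraph k (carr N)) ` carr N = carr B"
    using kN finN by (metis image_cong vapp_fgraph)
  ultimately have "isomorphism L (fgraph k (carr N)) N B" unfolding isomorphism_def by blast
  moreover have "fgraph k (carr N) \<in> V"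
    using finN N fin kN carr_subset[OF B] by (intro fgraph_in) auto
  ultimately show ?thesis using K_isomorphic NK B by blast
qed

lemma K_pullback:
  assumes M: "M \<in> K" and S: "finite S" "S \<subseteq> V" and h: "h ` S \<subseteq> carr M" "inj_on h S"
  shows "\<exists>B\<in>K. carr B = S \<and> preserves L h B M S"
proof -
  obtain B where B: "B \<in> V" "is_structure L B" "carr B = S" "preserves L h B M S"
    using ex_pullback[OF K_member(1,2)[OF M] S h] unfolding preserves_def by blast
  moreover have "B \<in> K" using B h by (intro K_embedded[OF B(1,2) M]) auto
  ultimately show ?thesis by blast
qed

text \<open>Every map fixes the empty tuple, so both structures agree with a common extension given
  by JEP.\<close>

lemma K_nullary:
  assumes "M \<in> K" "N \<in> K" "R \<in> vdom L" "arity L R = 0"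
  shows "vtuple [] \<in> interp M R \<longleftrightarrow> vtuple [] \<in> interp N R"
proof -
  obtain M3 j1 j2 where "embedding L j1 M M3" "embedding L j2 N M3"
    using Fraisse assms(1,2) unfolding strong_Fraisse_class_def JEP_def by blast
  then have "preserves L (vapp j1) M M3 (carr M)" "preserves L (vapp j2) N M3 (carr N)"
    unfolding embedding_iff by blast+
  from preservesD[OF this(1) assms(3), of "[]"] preservesD[OF this(2) assms(3), of "[]"] show ?thesis
    using assms(4) by simp
qed

text \<open>Only nullary relations have tuples over the empty set. It follows that any two members
  can be amalgamated over the empty set.\<close>

lemma preserves_empty: "M \<in> K \<Longrightarrow> N \<in> K \<Longrightarrow> preserves L h M N {}"
  unfolding preserves_def using K_nullary[of M N] by auto

text \<open>Strong amalgamation over \<open>S\<close> keeps the new point \<open>z\<close> of \<open>M\<close> outside of \<open>A\<close>.\<close>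
lemma one_point_extension:
  assumes A: "A \<in> K" and x: "x \<in> V" "x \<notin> carr A" and M: "M \<in> K" and S: "S \<subseteq> carr A"
    and h: "h ` S \<subseteq> carr M" "inj_on h S" "preserves L h A M S"
    and z: "z \<in> carr M" "z \<notin> h ` S"
  shows "\<exists>B\<in>K. substructure L A B \<and> carr B = insert x (carr A) \<and> preserves L (h(x := z)) B M (insert x S)"
proof -
  note A' = K_member[OF A] and M' = K_member[OF M]
  have S': "finite S" "S \<subseteq> V" using S A' finite_subset by blast+
  \<comment> \<open>The base of the amalgamation is \<open>S\<close> with the structure induced from
    \<open>A\<close>, which by assumption \<open>h\<close> carries to the one induced from
    \<open>M\<close>.\<close>
  obtain N where N: "N \<in> K" "carr N = S" "preserves L id N A S"
    using K_pullback[OF A S', of id] S by auto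
  have "preserves L h N M S"
    unfolding preserves_def
  proof (intro ballI allI impI)
    fix R as assume "R \<in> vdom L" "length as = arity L R \<and> set as \<subseteq> S"
    then show "vtuple as \<in> interp N R \<longleftrightarrow> vtuple (map h as) \<in> interp M R"
      using preservesD[OF N(3), of R as] preservesD[OF h(3), of R as] by simp
  qed
  then have "embedding L (fgraph id S) N A" "embedding L (fgraph h S) N M"
    using embedding_fgraph[of N L id A] embedding_fgraph[of N L h M] N S S' h by auto
  moreover have "fgraph id S \<in> V" "fgraph h S \<in> V"
    using S' h M' by (auto intro!: fgraph_in)
  ultimately obtain M3 j1 j2 where M3: "M3 \<in> K" and j: "embedding L j1 A M3" "embedding L j2 M M3"
    and comm: "\<forall>a\<in>carr N. vapp j1 (vapp (fgraph id S) a) = vapp j2 (vapp (fgraph h S) a)"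
    and disj: "vapp j1 ` carr A \<inter> vapp j2 ` carr M = (\<lambda>a. vapp j1 (vapp (fgraph id S) a)) ` carr N"
    using Fraisse N(1) A M unfolding strong_Fraisse_class_def SAP_def by metis
  have j1: "vapp j1 ` carr A \<subseteq> carr M3" "inj_on (vapp j1) (carr A)" "preserves L (vapp j1) A M3 (carr A)"
    using j(1) unfolding embedding_iff maps_def by auto
  have j2: "vapp j2 ` carr M \<subseteq> carr M3" "inj_on (vapp j2) (carr M)" "preserves L (vapp j2) M M3 (carr M)"
    using j(2) unfolding embedding_iff maps_def by auto
  have comm: "vapp j1 a = vapp j2 (h a)" if "a \<in> S" for a
    using comm that S' N by (simp add: vapp_fgraph)
  \<comment> \<open>This is where strongness enters: a common point would be the image of a point of
    \<open>S\<close>, which would put \<open>z\<close> into the image of \<open>S\<close> under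
    \<open>h\<close>.\<close>
  have y: "vapp j2 z \<notin> vapp j1 ` carr A"
  proof
    assume "vapp j2 z \<in> vapp j1 ` carr A"
    then have "vapp j2 z \<in> (\<lambda>a. vapp j1 (vapp (fgraph id S) a)) ` carr N" using disj z by blast
    then obtain a where a: "a \<in> S" and "vapp j2 z = vapp j2 (h a)"
      using comm N S' by (auto simp: vapp_fgraph)
    moreover have "h a \<in> carr M" using a h(1) by blast
    ultimately have "z = h a" using j2(2) z(1) by (simp add: inj_on_eq_iff)
    then show False using z(2) a by blast
  qed
  \<comment> \<open>The carrier of the amalgam is arbitrary. Pulling its structure back along
    \<open>k\<close> turns the copy of \<open>A\<close> into \<open>A\<close> itself, calls the new
    point \<open>x\<close> and drops all other points.\<close>
  define k where "k = (vapp j1)(x := vapp j2 z)"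
  have kA: "k a = vapp j1 a" if "a \<in> carr A" for a using that x by (auto simp: k_def)
  have kx: "k x = vapp j2 z" by (simp add: k_def)
  have im: "k ` carr A = vapp j1 ` carr A" using kA by (rule image_cong[OF refl])
  have "inj_on k (carr A)" using j1(2) kA by (simp add: inj_on_def)
  then have inj: "inj_on k (insert x (carr A))" using y im kx x by simp
  have sub: "k ` insert x (carr A) \<subseteq> carr M3" using im kx j1(1) j2(1) z by auto
  have "finite (insert x (carr A))" "insert x (carr A) \<subseteq> V" using A' x by auto
  from K_pullback[OF M3 this sub inj] obtain B where
    B: "B \<in> K" "carr B = insert x (carr A)" "preserves L k B M3 (insert x (carr A))" by blast
  have "preserves L id A B (carr A)"
    unfolding preserves_def
  proof (intro ballI allI impI)
    fix R as assume R: "R \<in> vdom L" and as: "length as = arity L R \<and> set as \<subseteq> carr A"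
    have eq: "map k as = map (vapp j1) as" using as kA by auto
    have "set as \<subseteq> insert x (carr A)" using as by blast
    then show "vtuple as \<in> interp A R \<longleftrightarrow> vtuple (map id as) \<in> interp B R"
      using preservesD[OF j1(3) R, of as] preservesD[OF B(3) R, of as, unfolded eq] as by simp
  qed
  then have "substructure L A B"
    unfolding substructure_iff using A' K_member[OF B(1)] B(2) by auto
  moreover have "preserves L (h(x := z)) B M (insert x S)"
    unfolding preserves_def
  proof (intro ballI allI impI)
    fix R as assume R: "R \<in> vdom L" and as: "length as = arity L R \<and> set as \<subseteq> insert x S"
    have "k a = vapp j2 ((h(x := z)) a)" if "a \<in> insert x S" for a
      using that kx kA comm S by auto
    then have eq: "map k as = map (vapp j2) (map (h(x := z)) as)" using as by auto
    have "set (map (h(x := z)) as) \<subseteq> carr M" using as h(1) z by auto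
    then have "vtuple (map (h(x := z)) as) \<in> interp M R \<longleftrightarrow> vtuple (map k as) \<in> interp M3 R"
      unfolding eq using as by (intro preservesD[OF j2(3) R]) auto
    moreover have "vtuple as \<in> interp B R \<longleftrightarrow> vtuple (map k as) \<in> interp M3 R"
      using as S by (intro preservesD[OF B(3) R]) auto
    ultimately show "vtuple as \<in> interp B R \<longleftrightarrow> vtuple (map (h(x := z)) as) \<in> interp M R" by simp
  qed
  ultimately show ?thesis using B by blast
qed


section \<open>A relation of minimal arity which is not homogeneous\<close>

text \<open>Injective valuations correspond to the distinct tuples in the notion of triviality.
  Variables may repeat in \<open>vs\<close>, so that tuples with repeated entries are covered by
  lists with fewer variables.\<close>

definition homogeneous :: "'a hset \<Rightarrow> nat list \<Rightarrow> bool" where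
  "homogeneous R vs \<longleftrightarrow> (\<exists>b. \<forall>M\<in>K. \<forall>s. inj_on s (set vs) \<and> s ` set vs \<subseteq> carr M \<longrightarrow>
    (vtuple (map s vs) \<in> interp M R \<longleftrightarrow> b))"

text \<open>On distinct tuples an equality of variables has a constant value, and negation keeps
  values constant; this leaves the relations.\<close>

lemma holds_of_homogeneous:
  assumes "\<forall>R\<in>vdom L. \<forall>vs. length vs = arity L R \<longrightarrow> homogeneous R vs" "literal_of L \<psi>"
  shows "\<exists>b. \<forall>M\<in>K. \<forall>as. length as = literal_arity \<psi> \<and> distinct as \<and> set as \<subseteq> carr M \<longrightarrow>
    (holds_of M \<psi> as \<longleftrightarrow> b)"
  using assms(2)
proof (induction \<psi>)
  \<comment> \<open>\<open>s F as\<close> is the valuation that \<open>holds_of\<close> uses for a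
    literal with free variables \<open>F\<close>; it is injective because \<open>as\<close> is
    distinct.\<close>
  define s where "s F as v = the (map_of (zip (sorted_list_of_set F) as) v)" for F :: "nat set" and as :: "'a hset list" and v
  have s: "inj_on (s F as) F \<and> s F as ` F \<subseteq> set as" if F: "finite F" "length as = card F" "distinct as" for F as
  proof -
    let ?xs = "sorted_list_of_set F"
    have len: "length ?xs = length as" using F by simp
    have nth: "s F as (?xs ! i) = as ! i" if "i < length as" for i
      using that len by (simp add: s_def map_of_zip_nth)
    have ex: "\<exists>i<length as. v = ?xs ! i" if "v \<in> F" for v
      using that F len by (metis in_set_conv_nth set_sorted_list_of_set)
    have "inj_on (s F as) F"
    proof (rule inj_onI)
      fix v w assume "v \<in> F" "w \<in> F" and eq: "s F as v = s F as w"
      then obtain i j where ij: "i < length as" "v = ?xs ! i" "j < length as" "w = ?xs ! j" using ex by meson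
      then show "v = w" using eq nth F(3) by (simp add: nth_eq_iff_index_eq)
    qed
    moreover have "s F as ` F \<subseteq> set as" using ex nth by (metis image_subsetI nth_mem)
    ultimately show ?thesis by blast
  qed
  {
    case (LRel R vs)
    then have "homogeneous R vs" using assms(1) by simp
    then obtain b where b: "\<forall>M\<in>K. \<forall>s. inj_on s (set vs) \<and> s ` set vs \<subseteq> carr M \<longrightarrow>
      (vtuple (map s vs) \<in> interp M R \<longleftrightarrow> b)" unfolding homogeneous_def by blast
    have "holds_of M (LRel R vs) as \<longleftrightarrow> b"
      if "M \<in> K" "length as = literal_arity (LRel R vs)" "distinct as" "set as \<subseteq> carr M" for M as
    proof -
      have "inj_on (s (set vs) as) (set vs) \<and> s (set vs) as ` set vs \<subseteq> carr M"
        using s[of "set vs" as] that by (auto simp: literal_arity_def)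
      then have "vtuple (map (s (set vs) as) vs) \<in> interp M R \<longleftrightarrow> b" using b that(1) by blast
      then show ?thesis by (simp add: holds_of_def s_def[abs_def])
    qed
    then show ?case by (intro exI[of _ b]) simp
  next
    case (LEq v w)
    have "holds_of M (LEq v w) as \<longleftrightarrow> v = w"
      if "M \<in> K" "length as = literal_arity (LEq v w :: 'a hset literal)" "distinct as" for M as
    proof -
      have "inj_on (s {v, w} as) {v, w}"
        using s[of "{v, w}" as] that by (auto simp: literal_arity_def)
      then have "s {v, w} as v = s {v, w} as w \<longleftrightarrow> v = w" by (auto simp: inj_on_def)
      then show ?thesis by (simp add: holds_of_def s_def[abs_def])
    qed
    then show ?case by (intro exI[of _ "v = w"]) simp
  next
    case (LNeg \<psi>)
    then obtain b where "\<forall>M\<in>K. \<forall>as. length as = literal_arity \<psi> \<and> distinct as \<and> set as \<subseteq> carr M \<longrightarrow>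
      (holds_of M \<psi> as \<longleftrightarrow> b)" by auto
    then have "\<forall>M\<in>K. \<forall>as. length as = literal_arity (LNeg \<psi>) \<and> distinct as \<and> set as \<subseteq> carr M \<longrightarrow>
      (holds_of M (LNeg \<psi>) as \<longleftrightarrow> \<not> b)" by (simp add: holds_of_def literal_arity_def)
    then show ?case by (intro exI[of _ "\<not> b"])
  }
qed

lemma ex_inhomogeneous:
  assumes "\<not> trivial_class L K"
  shows "\<exists>R\<in>vdom L. \<exists>vs. length vs = arity L R \<and> \<not> homogeneous R vs"
proof (rule ccontr)
  assume "\<not> ?thesis"
  then have const: "\<forall>R\<in>vdom L. \<forall>vs. length vs = arity L R \<longrightarrow> homogeneous R vs" by blast
  have "trivial_class L K"
    unfolding trivial_class_def
  proof (intro allI impI)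
    fix \<psi> :: "'a hset literal" assume "literal_of L \<psi>"
    from holds_of_homogeneous[OF const this]
    obtain b where b: "\<forall>M\<in>K. \<forall>as. length as = literal_arity \<psi> \<and> distinct as \<and> set as \<subseteq> carr M \<longrightarrow>
      (holds_of M \<psi> as \<longleftrightarrow> b)" ..
    have "holds_of M (LNeg \<psi>) as \<longleftrightarrow> \<not> holds_of M \<psi> as" "literal_arity (LNeg \<psi>) = literal_arity \<psi>" for M as
      by (simp_all add: holds_of_def literal_arity_def)
    then show "holds_of_all_distinct_tuples K \<psi> \<or> holds_of_all_distinct_tuples K (LNeg \<psi>)"
      unfolding holds_of_all_distinct_tuples_def using b by (cases b) auto
  qed
  with assms show False by blast
qed

text \<open>If \<open>b\<close> were never attained, the relation would be constant with the
  opposite value.\<close>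

lemma inhomogeneous_value:
  assumes "\<not> homogeneous R vs"
  obtains M s where "M \<in> K" "inj_on s (set vs)" "s ` set vs \<subseteq> carr M" "vtuple (map s vs) \<in> interp M R \<longleftrightarrow> b"
  using assms unfolding homogeneous_def by (metis (full_types))

lemma inhomogeneous_nonempty:
  assumes "R \<in> vdom L" "length vs = arity L R" "\<not> homogeneous R vs" shows "vs \<noteq> []"
proof
  assume [simp]: "vs = []"
  obtain M s where M: "M \<in> K" "vtuple (map s vs) \<in> interp M R \<longleftrightarrow> True" by (rule inhomogeneous_value[OF assms(3)])
  obtain N s' where N: "N \<in> K" "vtuple (map s' vs) \<in> interp N R \<longleftrightarrow> False" by (rule inhomogeneous_value[OF assms(3)])
  show False using K_nullary[OF M(1) N(1) assms(1)] M N assms(2) by simp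
qed

lemma ex_minimal_inhomogeneous:
  assumes "\<not> trivial_class L K"
  obtains R vs where "R \<in> vdom L" "length vs = arity L R" "\<not> homogeneous R vs"
    "\<And>R' vs'. R' \<in> vdom L \<Longrightarrow> length vs' = arity L R' \<Longrightarrow> card (set vs') < card (set vs) \<Longrightarrow> homogeneous R' vs'"
proof -
  let ?P = "\<lambda>(R, vs). R \<in> vdom L \<and> length vs = arity L R \<and> \<not> homogeneous R vs"
  obtain Rvs where Rvs: "?P Rvs" using ex_inhomogeneous[OF assms] by auto
  from ex_has_least_nat[of ?P, OF this, of "\<lambda>(R, vs). card (set vs)"]
  obtain R vs where "?P (R, vs)" "\<forall>R' vs'. ?P (R', vs') \<longrightarrow> card (set vs) \<le> card (set vs')" by auto
  then show thesis using that[of R vs] by (auto simp: not_less[symmetric])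
qed

end


section \<open>The Cohen generic filter\<close>

lemma elts_subset_fgraph_iff:
  assumes "finite S"
  shows "elts p \<subseteq> elts (fgraph h S) \<longleftrightarrow> (\<forall>z\<in>elts p. \<exists>x\<in>S. z = vpair x (h x))"
  by (auto simp: elts_fgraph[OF assms])

lemma subset_fgraph_Cohen:
  assumes S: "finite S" "S \<subseteq> elts X" "h ` S \<subseteq> {vnat 0, vnat 1}" and p: "elts p \<subseteq> elts (fgraph h S)"
  shows "p \<in> Cohen_conditions X"
proof -
  have "finite (elts p)" using p S(1) finite_subset by (fastforce simp: elts_fgraph)
  moreover have dom: "vdom p \<subseteq> S" using p by (auto simp: vdom_def elts_fgraph[OF S(1)])
  moreover have fun_p: "is_fun p"
    using is_fun_fgraph[OF S(1), of h] p unfolding is_fun_def by (meson subsetD)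
  moreover have "vapp p a \<in> {vnat 0, vnat 1}" if "a \<in> vdom p" for a
  proof -
    have "vpair a (vapp p a) \<in> elts (fgraph h S)" using vpair_vapp[OF fun_p that] p by blast
    then have "vapp p a = h a" "a \<in> S" by (auto simp: elts_fgraph[OF S(1)])
    then show ?thesis using S(3) by auto
  qed
  ultimately show ?thesis unfolding Cohen_conditions_def maps_def using S(2) by auto
qed

locale Fraisse_forcing = strong_Fraisse V L K for V :: "'a hset set" and L K +
  fixes X R :: "'a hset" and vs :: "nat list" and v :: nat and a :: "nat \<Rightarrow> 'a hset"
  assumes X: "X \<in> V"
    and R: "R \<in> vdom L" "length vs = arity L R" "\<not> homogeneous R vs"
    and minimal: "\<And>R' vs'. R' \<in> vdom L \<Longrightarrow> length vs' = arity L R' \<Longrightarrow>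
      card (set vs') < card (set vs) \<Longrightarrow> homogeneous R' vs'"
    and v: "v \<in> set vs"
    and a: "inj_on a (set vs - {v})" "a ` (set vs - {v}) \<subseteq> elts X"
begin

abbreviation "S0 \<equiv> a ` (set vs - {v})"
abbreviation "C \<equiv> C_conditions X K"
abbreviation "tup x \<equiv> vtuple (map (a(v := x)) vs)"

lemma X_subset: "elts X \<subseteq> V"
  using X elts_subset by blast

lemma C_member:
  assumes "A \<in> C" shows "A \<in> K" "carr A \<subseteq> elts X" "finite (carr A)" "is_structure L A" "A \<in> V"
  using assms K_member unfolding C_conditions_def by blast+

lemma extend_carrier:
  assumes "A \<in> C" "x \<in> elts X"
  shows "\<exists>B\<in>C. substructure L A B \<and> carr B = insert x (carr A)"
proof (cases "x \<in> carr A")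
  case True
  then show ?thesis using C_member[OF assms(1)] assms(1) substructure_refl by (metis insert_absorb)
next
  case False
  \<comment> \<open>The value of \<open>v\<close> is a point of \<open>M\<close>, which is added to
    \<open>A\<close> under the name \<open>x\<close> by amalgamation over the empty set. The truth
    value \<open>True\<close> is an arbitrary choice.\<close>
  obtain M s where M: "M \<in> K" "s ` set vs \<subseteq> carr M" "vtuple (map s vs) \<in> interp M R \<longleftrightarrow> True"
    by (rule inhomogeneous_value[OF R(3)])
  have "s v \<in> carr M" "x \<in> V" using M v X_subset assms(2) by blast+
  then obtain B where "B \<in> K" "substructure L A B" "carr B = insert x (carr A)"
    using one_point_extension[of A x M "{}" id "s v"] preserves_empty[of A M id] C_member[OF assms(1)]
      M False X_subset assms(2) by auto
  moreover from this have "B \<in> C" using C_member(2)[OF assms(1)] assms(2) unfolding C_conditions_def by simp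
  ultimately show ?thesis by blast
qed

lemma extend_carrier_set:
  assumes "finite T" "T \<subseteq> elts X" "A \<in> C"
  shows "\<exists>B\<in>C. substructure L A B \<and> carr B = T \<union> carr A"
  using assms(1,2)
proof (induction T rule: finite_induct)
  case empty
  show ?case using substructure_refl C_member[OF assms(3)] assms(3) by auto
next
  case (insert x T)
  then obtain B where B: "B \<in> C" "substructure L A B" "carr B = T \<union> carr A" by auto
  obtain B' where "B' \<in> C" "substructure L B B'" "carr B' = insert x (carr B)"
    using extend_carrier[OF B(1), of x] insert.prems by auto
  then show ?case using B substructure_trans[of L A B B'] by (intro bexI[of _ B']) auto
qed

text \<open>By minimality, the relations on the points \<open>S0\<close> are the same in all structures, so that the
  truth value of \<open>R\<close> at \<open>tup x\<close> can be prescribed for a new point \<open>x\<close>.\<close>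
lemma extend_decide:
  assumes A: "A \<in> C" "S0 \<subseteq> carr A" and x: "x \<in> elts X" "x \<notin> carr A"
  shows "\<exists>B\<in>C. substructure L A B \<and> carr B = insert x (carr A) \<and> (tup x \<in> interp B R \<longleftrightarrow> b)"
proof -
  obtain M s where M: "M \<in> K" "inj_on s (set vs)" "s ` set vs \<subseteq> carr M"
    "vtuple (map s vs) \<in> interp M R \<longleftrightarrow> b"
    by (rule inhomogeneous_value[OF R(3)])
  note A' = C_member[OF A(1)]
  define F where "F = set vs - {v}"
  have F: "inj_on a F" "S0 = a ` F" "v \<notin> F" "set vs = insert v F" "finite F"
    using a v by (auto simp: F_def)
  \<comment> \<open>\<open>h\<close> sends the fixed point of a variable to the value of that
    variable in \<open>M\<close>.\<close>
  define h where "h = (\<lambda>y. s (inv_into F a y))"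
  have ha: "h (a w) = s w" if "w \<in> F" for w using that F by (simp add: h_def)
  have hS: "h ` S0 = s ` F" using ha F(2) by (simp add: image_image)
  have inj_s: "inj_on s F" "s v \<notin> s ` F" using M(2) F(3,4) by auto
  have "inj_on h S0"
    unfolding F(2) using inj_s ha by (auto simp: inj_on_def)
  moreover have "preserves L h A M S0"
    unfolding preserves_def
  proof (intro ballI allI impI)
    fix R' as assume R': "R' \<in> vdom L" and as: "length as = arity L R' \<and> set as \<subseteq> S0"
    \<comment> \<open>Rewritten in variables, a tuple of fixed points uses variables from
      \<open>F\<close> only, fewer than \<open>vs\<close> has. Minimality gives it the same truth
      value under \<open>a\<close> in \<open>A\<close> as under \<open>s\<close> in
      \<open>M\<close>.\<close>
    define ws where "ws = map (inv_into F a) as"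
    have ws: "set ws \<subseteq> F" "length ws = arity L R'"
      using as F(2) by (auto simp: ws_def inv_into_into)
    have as_eq: "map a ws = as" unfolding ws_def using as F(2) by (auto simp: f_inv_into_f subset_iff intro!: map_idI)
    have has_eq: "map h as = map s ws" by (simp add: ws_def h_def)
    have "card (set ws) \<le> card F" using ws F by (simp add: card_mono)
    also have "\<dots> < card (set vs)" using F by simp
    finally have "card (set ws) < card (set vs)" .
    from minimal[OF R' ws(2) this] obtain b' where b': "\<forall>M\<in>K. \<forall>s. inj_on s (set ws) \<and> s ` set ws \<subseteq> carr M \<longrightarrow>
      (vtuple (map s ws) \<in> interp M R' \<longleftrightarrow> b')" unfolding homogeneous_def ..
    have "a ` set ws \<subseteq> a ` F" "s ` set ws \<subseteq> s ` set vs" using ws(1) F(4) by auto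
    then have "a ` set ws \<subseteq> carr A" "s ` set ws \<subseteq> carr M" using A(2) M(3) F(2) by auto
    moreover have "inj_on a (set ws)" "inj_on s (set ws)"
      using inj_on_subset[OF F(1) ws(1)] inj_on_subset[OF inj_s(1) ws(1)] .
    ultimately have "vtuple (map a ws) \<in> interp A R' \<longleftrightarrow> vtuple (map s ws) \<in> interp M R'"
      using b' A'(1) M(1) by simp
    then show "vtuple as \<in> interp A R' \<longleftrightarrow> vtuple (map h as) \<in> interp M R'"
      unfolding as_eq has_eq .
  qed
  moreover have "h ` S0 \<subseteq> carr M" "s v \<in> carr M" "s v \<notin> h ` S0" "x \<in> V"
    using hS M(3) F(4) inj_s x X_subset by auto
  ultimately obtain B where B: "B \<in> K" "substructure L A B" "carr B = insert x (carr A)"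
    "preserves L (h(x := s v)) B M (insert x S0)"
    using one_point_extension[OF A'(1) _ x(2) M(1) A(2), of h "s v"] by blast
  \<comment> \<open>The extended map turns the valuation \<open>a(v := x)\<close> into
    \<open>s\<close>, for which \<open>R\<close> has the value \<open>b\<close>. The fixed points
    lie in \<open>A\<close> and so differ from \<open>x\<close>.\<close>
  have "(h(x := s v)) ((a(v := x)) w) = s w" if "w \<in> set vs" for w
  proof (cases "w = v")
    case False
    then have "w \<in> F" using that F by auto
    then have "a w \<noteq> x" using A(2) x(2) F(2) by auto
    then show ?thesis using False ha \<open>w \<in> F\<close> by simp
  qed simp
  then have eq: "map (h(x := s v)) (map (a(v := x)) vs) = map s vs" by auto
  have "set (map (a(v := x)) vs) \<subseteq> insert x S0" by auto
  then have "tup x \<in> interp B R \<longleftrightarrow> b"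
    using preservesD[OF B(4) R(1), of "map (a(v := x)) vs", unfolded eq] R(2) M(4) by simp
  moreover have "B \<in> C" using B A' x unfolding C_conditions_def by auto
  ultimately show ?thesis using B by blast
qed

text \<open>The value \<open>0\<close> on the finite set \<open>S0\<close> is an arbitrary choice: every function on a finite set is
  Cohen generic.\<close>
definition value_at :: "'a hset \<Rightarrow> 'a hset \<Rightarrow> bool" where
  "value_at A x \<longleftrightarrow> x \<notin> S0 \<and> tup x \<in> interp A R"

text \<open>On the conditions containing \<open>S0\<close> this is a projection to Cohen forcing: it
  is monotone by \<open>code_mono\<close>, and by \<open>extend_Cohen\<close> each Cohen condition
  below \<open>code A\<close> is contained in \<open>code B\<close> for some extension
  \<open>B\<close> of \<open>A\<close>.\<close>

definition code :: "'a hset \<Rightarrow> 'a hset" where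
  "code A = fgraph (\<lambda>x. if value_at A x then vnat 1 else vnat 0) (carr A)"

text \<open>All entries of \<open>tup x\<close> lie in \<open>A\<close>, so that an extension cannot
  change the truth value.\<close>

lemma value_at_substructure:
  assumes "substructure L A B" "S0 \<subseteq> carr A" "x \<in> carr A" shows "value_at B x \<longleftrightarrow> value_at A x"
proof -
  have "preserves L id A B (carr A)" using assms(1) unfolding substructure_iff by blast
  moreover have "set (map (a(v := x)) vs) \<subseteq> carr A" using assms by auto
  ultimately have "tup x \<in> interp A R \<longleftrightarrow> tup x \<in> interp B R"
    using preservesD[OF _ R(1), of id A B "carr A" "map (a(v := x)) vs"] R(2) by simp
  then show ?thesis by (simp add: value_at_def)
qed

lemma elts_code: "A \<in> C \<Longrightarrow> elts (code A) = (\<lambda>x. vpair x (if value_at A x then vnat 1 else vnat 0)) ` carr A"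
  unfolding code_def by (simp add: elts_fgraph C_member)

lemma code_mono:
  assumes "A \<in> C" "B \<in> C" "substructure L A B" "S0 \<subseteq> carr A"
  shows "elts (code A) \<subseteq> elts (code B)"
proof -
  have "carr A \<subseteq> carr B" using assms(3) unfolding substructure_iff by blast
  moreover have "(\<lambda>x. vpair x (if value_at A x then vnat 1 else vnat 0)) ` carr A =
      (\<lambda>x. vpair x (if value_at B x then vnat 1 else vnat 0)) ` carr A"
    using value_at_substructure[OF assms(3,4)] by (intro image_cong refl) simp
  ultimately show ?thesis unfolding elts_code[OF assms(1)] elts_code[OF assms(2)] by auto
qed

lemma code_Cohen: "A \<in> C \<Longrightarrow> elts p \<subseteq> elts (code A) \<Longrightarrow> p \<in> Cohen_conditions X"
  unfolding code_def by (erule subset_fgraph_Cohen[rotated 3]) (auto simp: C_member)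

lemma code_in: "A \<in> C \<Longrightarrow> code A \<in> V"
  unfolding code_def
  using C_member[of A] X_subset by (intro fgraph_in) (auto simp del: vnat.simps intro: vnat_in)

text \<open>The new points are decided one at a time, and decisions persist in extensions. Points of
  \<open>A\<close> have their values already, hence the restriction to
  \<open>T - carr A\<close>.\<close>

lemma extend_code:
  assumes "finite T" "T \<subseteq> elts X" "A \<in> C" "S0 \<subseteq> carr A"
  shows "\<exists>B\<in>C. substructure L A B \<and> carr B = T \<union> carr A \<and> (\<forall>x\<in>T - carr A. value_at B x \<longleftrightarrow> f x)"
  using assms(1,2)
proof (induction T rule: finite_induct)
  case empty
  show ?case using substructure_refl C_member[OF assms(3)] assms(3) by auto
next
  case (insert x T)
  then obtain B where B: "B \<in> C" "substructure L A B" "carr B = T \<union> carr A"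
    "\<forall>x\<in>T - carr A. value_at B x \<longleftrightarrow> f x" by auto
  show ?case
  proof (cases "x \<in> carr A")
    case True
    then show ?thesis using B by (intro bexI[of _ B]) auto
  next
    case False
    then have "x \<notin> carr B" using B insert.hyps by simp
    moreover have S0: "S0 \<subseteq> carr B" using B assms(4) by blast
    ultimately obtain B' where B': "B' \<in> C" "substructure L B B'" "carr B' = insert x (carr B)"
      "tup x \<in> interp B' R \<longleftrightarrow> f x"
      using extend_decide[OF B(1), of x "f x"] insert.prems by auto
    have "value_at B' y \<longleftrightarrow> f y" if "y \<in> insert x T - carr A" for y
    proof (cases "y = x")
      case True
      \<comment> \<open>Since \<open>S0\<close> is contained in \<open>carr A\<close>, the point
        \<open>x\<close> is outside of \<open>S0\<close> and the default value does not
        interfere.\<close>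
      then show ?thesis using B'(4) False assms(4) unfolding value_at_def by blast
    next
      case False
      then have "y \<in> carr B" "y \<in> T - carr A" using that B by auto
      then show ?thesis using value_at_substructure[OF B'(2) S0] B(4) by blast
    qed
    then show ?thesis using B B' substructure_trans[OF B(2) B'(2)] by (intro bexI[of _ B']) auto
  qed
qed

text \<open>On \<open>carr A\<close> the function \<open>d\<close> agrees with
  \<open>code A\<close>; elsewhere its values are still free to be prescribed.\<close>

lemma extend_Cohen:
  assumes A: "A \<in> C" "S0 \<subseteq> carr A" and d: "d \<in> Cohen_conditions X" "elts (code A) \<subseteq> elts d"
  shows "\<exists>B\<in>C. substructure L A B \<and> elts d \<subseteq> elts (code B)"
proof -
  have fin: "finite (elts d)" and dom: "vdom d \<subseteq> elts X" and "maps d (vdom d) {vnat 0, vnat 1}"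
    using d(1) unfolding Cohen_conditions_def by blast+
  then have fun_d: "is_fun d" and val: "\<And>x. x \<in> vdom d \<Longrightarrow> vapp d x \<in> {vnat 0, vnat 1}"
    unfolding maps_def by blast+
  have "vdom d \<subseteq> vfst ` elts d" unfolding vdom_def by force
  then have "finite (vdom d)" using fin finite_surj by blast
  then obtain B where B: "B \<in> C" "substructure L A B" "carr B = vdom d \<union> carr A"
    "\<forall>x\<in>vdom d - carr A. value_at B x \<longleftrightarrow> vapp d x = vnat 1"
    using extend_code[OF _ dom A, of "\<lambda>x. vapp d x = vnat 1"] by blast
  have "elts d \<subseteq> elts (code B)"
  proof
    fix z assume z: "z \<in> elts d"
    then obtain x c where xc: "z = vpair x c" using fun_d unfolding is_fun_def by metis
    then have x: "x \<in> vdom d" "vapp d x = c" using z vapp_eqI[OF fun_d] unfolding vdom_def by auto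
    show "z \<in> elts (code B)"
    proof (cases "x \<in> carr A")
      case True
      then have "vpair x (if value_at A x then vnat 1 else vnat 0) \<in> elts (code A)" using A by (auto simp: elts_code)
      then have "z \<in> elts (code A)" using d(2) vapp_eqI[OF fun_d] x xc by (metis subsetD)
      then show ?thesis using code_mono[OF A(1) B(1,2) A(2)] by blast
    next
      case False
      then have "value_at B x \<longleftrightarrow> c = vnat 1" using B(4) x by blast
      moreover have "c \<in> {vnat 0, vnat 1}" using val x by blast
      ultimately have "c = (if value_at B x then vnat 1 else vnat 0)" by auto
      then show ?thesis using x B(1,3) xc by (auto simp: elts_code simp del: vnat.simps)
    qed
  qed
  then show ?thesis using B by blast
qed

text \<open>This is the right-hand side of \<open>good_iff\<close> written with quantifiers over
  \<open>V\<close> and parameters from \<open>V\<close>, so that definability can be checked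
  connective by connective. \<open>J\<close> stands for the interpretation of \<open>R\<close> in
  \<open>A\<close>.\<close>

definition good :: "'a hset \<Rightarrow> 'a hset \<Rightarrow> bool" where
  "good p A \<longleftrightarrow> (\<exists>B\<in>V. \<exists>I\<in>V. \<exists>J\<in>V. A = vpair B I \<and> vpair R J \<in> elts I \<and> (\<forall>y\<in>elts (vset S0). y \<in> elts B) \<and>
    (\<forall>z\<in>elts p. \<exists>x\<in>elts B. (z = vpair x (vnat 1) \<and> x \<notin> elts (vset S0) \<and> tup x \<in> elts J) \<or>
      (z = vpair x (vnat 0) \<and> \<not> (x \<notin> elts (vset S0) \<and> tup x \<in> elts J))))"

lemma S0_in: "vset S0 \<in> V" "elts (vset S0) = S0"
  using a(2) X_subset by (auto intro!: finite_in simp: elts_vset_finite)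

lemma R_in: "R \<in> V"
  using R(1) L vpair_mem_in unfolding vdom_def by blast

lemma dfn_good: "dfn V (\<lambda>e. good (e i) (e j))"
proof -
  have "dfn_tm V (\<lambda>e. tup (e k))" for k
  proof -
    have "dfn_tm V (\<lambda>e. vtuple (map (\<lambda>w. (a(v := e k)) w) vs))"
    proof (rule dfn_tm_vtuple)
      fix w assume "w \<in> set vs"
      then show "dfn_tm V (\<lambda>e. (a(v := e k)) w)"
        using a(2) X_subset by (cases "w = v") (auto intro!: dfn_tm_var dfn_tm_const)
    qed
    then show ?thesis .
  qed
  then show ?thesis
    unfolding good_def by (intro dfn_intros S0_in R_in vnat_in)
qed

lemma good_iff:
  assumes A: "A \<in> C" shows "good p A \<longleftrightarrow> S0 \<subseteq> carr A \<and> elts p \<subseteq> elts (code A)"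
proof -
  obtain B I where BI: "A = vpair B I" "is_fun I" "vdom I = vdom L"
    using C_member[OF A] unfolding is_structure_def maps_def by blast
  then have V: "B \<in> V" "I \<in> V" using C_member(5)[OF A] vpair_elts_in by blast+
  have J: "vpair R (vapp I R) \<in> elts I" using vpair_vapp[OF BI(2)] R(1) BI(3) by blast
  then have JV: "vapp I R \<in> V" using vpair_mem_in V by blast
  have J_iff: "vpair R J \<in> elts I \<longleftrightarrow> J = vapp I R" for J using J vapp_eqI[OF BI(2)] by blast
  have ex: "(\<exists>B\<in>V. \<exists>I\<in>V. \<exists>J\<in>V. A = vpair B I \<and> vpair R J \<in> elts I \<and> Q B J) \<longleftrightarrow> Q B (vapp I R)" for Q
    using V JV J_iff unfolding BI(1) by auto
  have carrA: "carr A = elts B" and interpA: "interp A R = elts (vapp I R)"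
    by (simp_all add: carr_def interp_def BI)
  have "good p A \<longleftrightarrow> S0 \<subseteq> carr A \<and> (\<forall>z\<in>elts p. \<exists>x\<in>carr A. (z = vpair x (vnat 1) \<and> value_at A x) \<or>
      (z = vpair x (vnat 0) \<and> \<not> value_at A x))"
    unfolding good_def value_at_def ex S0_in(2) carrA interpA by (simp only: subset_iff Ball_def)
  also have "(\<forall>z\<in>elts p. \<exists>x\<in>carr A. (z = vpair x (vnat 1) \<and> value_at A x) \<or> (z = vpair x (vnat 0) \<and> \<not> value_at A x)) \<longleftrightarrow>
      elts p \<subseteq> elts (code A)"
    unfolding code_def elts_subset_fgraph_iff[OF C_member(3)[OF A]]
    by (intro ball_cong bex_cong refl) (simp del: vnat.simps)
  finally show ?thesis .
qed

text \<open>Pulling back to the empty set leaves the nullary relations only, whose values are the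
  same throughout \<open>K\<close>. The result is the weakest condition.\<close>

lemma ex_empty_structure: "\<exists>u\<in>C. carr u = {} \<and> (\<forall>A\<in>C. substructure L u A)"
proof -
  obtain M s where M: "M \<in> K" "vtuple (map s vs) \<in> interp M R \<longleftrightarrow> True"
    by (rule inhomogeneous_value[OF R(3)])
  obtain u where u: "u \<in> K" "carr u = {}"
    using K_pullback[OF M(1), of "{}" id] by auto
  moreover have "substructure L u A" if "A \<in> C" for A
    using that u K_member[OF u(1)] C_member[OF that] preserves_empty[OF u(1)] by (simp add: substructure_iff)
  ultimately show ?thesis unfolding C_conditions_def by blast
qed

lemma ex_Cohen_generic:
  assumes G: "generic_over V C (C_le L) G"
  shows "\<exists>H\<in>generic_extension V C G. generic_over V (Cohen_conditions X) Cohen_le H"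
proof -
  have filter: "elts G \<subseteq> C" "elts G \<noteq> {}" "\<And>p q. p \<in> elts G \<Longrightarrow> q \<in> C \<Longrightarrow> substructure L q p \<Longrightarrow> q \<in> elts G"
    "\<And>p q. p \<in> elts G \<Longrightarrow> q \<in> elts G \<Longrightarrow> \<exists>r\<in>elts G. substructure L p r \<and> substructure L q r"
    and dense: "\<And>D. D \<in> V \<Longrightarrow> dense_set C (C_le L) (elts D) \<Longrightarrow> elts G \<inter> elts D \<noteq> {}"
    using G unfolding generic_over_def filter_on_def C_le_def by blast+
  obtain c where c: "c \<in> V" "elts c = C"
    using ex_C_conditions[OF X L K_class] K_member(2) by blast
  obtain u where u: "u \<in> C" "\<And>A. A \<in> C \<Longrightarrow> substructure L u A" using ex_empty_structure by blast
  have uG: "u \<in> elts G" using filter u by blast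
  have uV: "u \<in> V" using C_member u by blast

  \<comment> \<open>Density arguments about Cohen conditions are transferred to \<open>G\<close>
    here: the conditions that are good for some element of \<open>D\<close> form a set in
    \<open>V\<close>, dense because any condition can be extended to contain
    \<open>S0\<close>.\<close>
  have meets: "\<exists>A\<in>elts G. \<exists>p\<in>elts D. good p A"
    if D: "D \<in> V" and ext: "\<And>A. A \<in> C \<Longrightarrow> S0 \<subseteq> carr A \<Longrightarrow> \<exists>B\<in>C. substructure L A B \<and> (\<exists>p\<in>elts D. good p B)" for D
  proof -
    have "dfn V (\<lambda>e. \<exists>p\<in>elts D. good p (e 0))"
      by (intro dfn_intros D dfn_good)
    from separation_dfn[OF c(1) this] obtain E where
      E: "E \<in> V" "elts E = {A \<in> elts c. \<exists>p\<in>elts D. good p A}" by blast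
    have "\<exists>d\<in>elts E. C_le L d A" if A: "A \<in> C" for A
    proof -
      obtain A' where A': "A' \<in> C" "substructure L A A'" "carr A' = S0 \<union> carr A"
        using extend_carrier_set[OF _ a(2) A] by auto
      then obtain B where B: "B \<in> C" "substructure L A' B" "\<exists>p\<in>elts D. good p B" using ext[of A'] by auto
      then have "B \<in> elts E" unfolding E c by blast
      then show ?thesis using substructure_trans[OF A'(2) B(2)] unfolding C_le_def by blast
    qed
    then have "dense_set C (C_le L) (elts E)" unfolding dense_set_def E c by blast
    from dense[OF E(1) this] show ?thesis unfolding E by blast
  qed

  \<comment> \<open>Bounds for separation: \<open>Z\<close> contains all partial functions from
    \<open>X\<close> to \<open>{0, 1}\<close> in \<open>V\<close>, \<open>Z'\<close> their canonical
    names, and \<open>W\<close> the pairs of such a name and a condition.\<close>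
  obtain b where b: "b \<in> V" "\<forall>x\<in>elts X. \<forall>y\<in>elts (vset {vnat 0, vnat 1}). vpair x y \<in> elts b"
    using ex_product_bound[OF X doubleton_in[OF vnat_in vnat_in]] by blast
  obtain Z where Z: "Z \<in> V" "elts Z = {y \<in> V. elts y \<subseteq> elts b}" using Pow_in[OF b(1)] by blast
  have "\<exists>Z'\<in>V. elts Z' = {q \<in> V. \<exists>p\<in>elts Z. q = check_name u p}"
    by (rule replacement_dfn[OF Z(1)]) (auto intro: dfn_check_name[OF uV])
  then obtain Z' where Z': "Z' \<in> V" "elts Z' = {q \<in> V. \<exists>p\<in>elts Z. q = check_name u p}" by blast
  obtain W where W: "W \<in> V" "\<forall>x\<in>elts Z'. \<forall>y\<in>elts c. vpair x y \<in> elts W"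
    using ex_product_bound[OF Z'(1) c(1)] by blast
  have "dfn V (\<lambda>e. \<exists>p\<in>V. \<exists>A\<in>elts c. e 0 = vpair (check_name u p) A \<and> good p A)"
    by (intro dfn_intros dfn_good dfn_tm_check_name uV c(1))
  from separation_dfn[OF W(1) this] obtain \<tau> where \<tau>: "\<tau> \<in> V"
    "elts \<tau> = {q \<in> elts W. \<exists>p\<in>V. \<exists>A\<in>elts c. q = vpair (check_name u p) A \<and> good p A}" by blast
  have \<tau>_eq: "elts \<tau> = {vpair (check_name u p) A | p A. p \<in> V \<and> A \<in> C \<and> good p A}"
  proof -
    have "vpair (check_name u p) A \<in> elts W" if "p \<in> V" "A \<in> C" "good p A" for p A
    proof -
      have "elts p \<subseteq> elts (code A)" using that good_iff by blast
      also have "elts (code A) \<subseteq> elts b"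
        using b(2) C_member(2)[OF that(2)] by (auto simp: elts_code[OF that(2)] elts_doubleton simp del: vnat.simps)
      finally have "p \<in> elts Z" unfolding Z using that by blast
      then have "check_name u p \<in> elts Z'" unfolding Z' using check_name_in[OF uV that(1)] by blast
      then show ?thesis using W(2) that(2) c(2) by blast
    qed
    then show ?thesis unfolding \<tau>(2) c(2) by blast
  qed
  define H where "H = val G \<tau>"
  have H: "elts H = {p \<in> V. \<exists>A\<in>elts G. good p A}"
  proof (intro equalityI subsetI)
    fix p assume "p \<in> elts H"
    then show "p \<in> {p \<in> V. \<exists>A\<in>elts G. good p A}"
      unfolding H_def elts_val \<tau>_eq by (auto simp: val_check_name[OF uG])
  next
    fix p assume "p \<in> {p \<in> V. \<exists>A\<in>elts G. good p A}"
    then obtain A where "p \<in> V" "A \<in> elts G" "good p A" by blast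
    then have "vpair (check_name u p) A \<in> elts \<tau>" using filter(1) unfolding \<tau>_eq by blast
    then have "val G (check_name u p) \<in> elts H" unfolding H_def elts_val using \<open>A \<in> elts G\<close> by blast
    then show "p \<in> elts H" by (simp add: val_check_name[OF uG])
  qed

  have "is_name C \<tau>"
    by (rule is_name.intros) (use is_name_check_name[OF u(1)] in \<open>auto simp: \<tau>_eq\<close>)
  then have "H \<in> generic_extension V C G" unfolding generic_extension_def H_def using \<tau>(1) by blast
  moreover have "generic_over V (Cohen_conditions X) Cohen_le H"
    unfolding generic_over_def filter_on_def
  proof (intro conjI ballI impI)
    show "elts H \<subseteq> Cohen_conditions X"
    proof
      fix p assume "p \<in> elts H"
      then obtain A where A: "A \<in> elts G" "good p A" unfolding H by blast
      then have "A \<in> C" using filter(1) by blast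
      then show "p \<in> Cohen_conditions X" using A(2) good_iff code_Cohen by simp
    qed
  next
    \<comment> \<open>The empty function is good for \<open>A\<close> as soon as \<open>A\<close>
      contains \<open>S0\<close>; that \<open>G\<close> has such an element follows by
      genericity.\<close>
    have "\<exists>A\<in>elts G. \<exists>p\<in>elts (vset {vset {}}). good p A"
    proof (rule meets)
      show "vset {vset {}} \<in> V" by (intro finite_in) (auto simp: empty_in)
      fix A assume A: "A \<in> C" "S0 \<subseteq> carr A"
      then have "good (vset {}) A" by (simp add: good_iff elts_vset_finite)
      then have "\<exists>p\<in>elts (vset {vset {}}). good p A" by (simp add: elts_vset_finite)
      then show "\<exists>B\<in>C. substructure L A B \<and> (\<exists>p\<in>elts (vset {vset {}}). good p B)"
        using substructure_refl[OF C_member(4)[OF A(1)]] A(1) by blast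
    qed
    then have "vset {} \<in> elts H" unfolding H by (simp add: elts_vset_finite empty_in)
    then show "elts H \<noteq> {}" by blast
  next
    fix p q assume p: "p \<in> elts H" and q: "q \<in> Cohen_conditions X" "Cohen_le p q"
    then obtain A where A: "p \<in> V" "A \<in> elts G" "good p A" unfolding H by blast
    \<comment> \<open>\<open>H\<close> collects elements of \<open>V\<close>, and \<open>q\<close>
      is one of them as a finite subset of \<open>V\<close>.\<close>
    have "elts q \<subseteq> V" "finite (elts q)" using q elts_subset[OF A(1)] unfolding Cohen_le_def Cohen_conditions_def by auto
    then have "q \<in> V" using finite_in[of "elts q"] by simp
    moreover have "good q A" using A filter(1) q(2) good_iff[of A] unfolding Cohen_le_def by blast
    ultimately show "q \<in> elts H" unfolding H using A by blast
  next
    fix p q assume "p \<in> elts H" "q \<in> elts H"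
    then obtain A B where AB: "A \<in> elts G" "good p A" "B \<in> elts G" "good q B" unfolding H by blast
    then obtain r where r: "r \<in> elts G" "substructure L A r" "substructure L B r" using filter(4) by blast
    have C: "A \<in> C" "B \<in> C" "r \<in> C" using AB r filter(1) by blast+
    have *: "S0 \<subseteq> carr A" "elts p \<subseteq> elts (code A)" "S0 \<subseteq> carr B" "elts q \<subseteq> elts (code B)"
      using AB C good_iff by blast+
    have "S0 \<subseteq> carr r" using *(1) r(2) unfolding substructure_iff by blast
    \<comment> \<open>The code of a common extension in \<open>G\<close> serves as the common lower
      bound.\<close>
    then have "code r \<in> elts H" unfolding H using r(1) code_in[OF C(3)] good_iff[OF C(3)] by blast
    moreover have "Cohen_le (code r) p" "Cohen_le (code r) q"
      unfolding Cohen_le_def using * code_mono[OF C(1,3) r(2)] code_mono[OF C(2,3) r(3)] by blast+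
    ultimately show "\<exists>r\<in>elts H. Cohen_le r p \<and> Cohen_le r q" by blast
  next
    fix D assume D: "D \<in> V" "dense_set (Cohen_conditions X) Cohen_le (elts D)"
    have "\<exists>A\<in>elts G. \<exists>p\<in>elts D. good p A"
    proof (rule meets[OF D(1)])
      fix A assume A: "A \<in> C" "S0 \<subseteq> carr A"
      \<comment> \<open>\<open>code A\<close> is itself a Cohen condition, so \<open>D\<close> has
        an element below it, which an extension of \<open>A\<close> realizes.\<close>
      obtain d where d: "d \<in> elts D" "elts (code A) \<subseteq> elts d" "d \<in> Cohen_conditions X"
        using D(2) code_Cohen[OF A(1) subset_refl] unfolding dense_set_def Cohen_le_def by blast
      obtain B where B: "B \<in> C" "substructure L A B" "elts d \<subseteq> elts (code B)"
        using extend_Cohen[OF A d(3,2)] by blast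
      have "S0 \<subseteq> carr B" using A(2) B(2) unfolding substructure_iff by blast
      then have "good d B" using good_iff[OF B(1)] B(3) by blast
      then show "\<exists>B\<in>C. substructure L A B \<and> (\<exists>p\<in>elts D. good p B)" using B d(1) by blast
    qed
    then show "elts H \<inter> elts D \<noteq> {}" unfolding H using elts_in D(1) by blast
  qed
  ultimately show ?thesis by blast
qed

end

theorem proposition4p4:
  fixes V :: "'a hset set" and X L G :: "'a hset" and K :: "'a hset set"
  assumes "model_of_set_theory V"
    and "X \<in> V" and "infinite (elts X)"
    and "L \<in> V" and "relational_language L"
    and "strong_Fraisse_class V L K"
    and "\<not> trivial_class L K"
    and "generic_over V (C_conditions X K) (C_le L) G"
  shows "\<exists>H \<in> generic_extension V (C_conditions X K) G.
    generic_over V (Cohen_conditions X) Cohen_le H"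
proof -
  interpret strong_Fraisse V L K
    by unfold_locales (use assms in auto)
  obtain R vs where R: "R \<in> vdom L" "length vs = arity L R" "\<not> homogeneous R vs"
    and minimal: "\<And>R' vs'. R' \<in> vdom L \<Longrightarrow> length vs' = arity L R' \<Longrightarrow> card (set vs') < card (set vs) \<Longrightarrow> homogeneous R' vs'"
    by (rule ex_minimal_inhomogeneous[OF assms(7)]) blast
  obtain v where v: "v \<in> set vs"
    using inhomogeneous_nonempty[OF R] by (metis hd_in_set)
  \<comment> \<open>As \<open>X\<close> is infinite, it has room for the fixed points, one for each
    variable other than \<open>v\<close>.\<close>
  obtain T where T: "T \<subseteq> elts X" "finite T" "card T = card (set vs - {v})"
    using infinite_arbitrarily_large[OF assms(3)] by metis
  then obtain a where a: "bij_betw a (set vs - {v}) T"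
    using finite_same_card_bij[of "set vs - {v}" T] by auto
  interpret Fraisse_forcing V L K X R vs v a
  proof unfold_locales
    show "inj_on a (set vs - {v})" "a ` (set vs - {v}) \<subseteq> elts X"
      using a T unfolding bij_betw_def by auto
  qed (use assms(2) R minimal v in auto)
  show ?thesis by (rule ex_Cohen_generic[OF assms(8)])
qed

end
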